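(* Let $(M,\nabla,g)$ be a compact Hessian manifold and let $u\in\mathcal{K}(M,g)$. Then there is a sequence $u_j\in\mathcal{K}(M,g)\cap\mathcal{C}^\infty(M)$ such that $u_j$ converges uniformly to $u$ on $M$ as $j\to\infty$.
   Context: An affine manifold $(M,\nabla)$ is a manifold with a flat torsion-free connection $\nabla$; equivalently it has an atlas of affine charts whose transition maps are (locally) affine maps $x\mapsto Ax+b$ of $\mathbb{R}^n$. A Hessian metric on $(M,\nabla)$ is a Riemannian metric $g$ which is locally of the form $g=\nabla d\phi$ with $\phi$ a smooth (strictly convex) function, i.e. $g_{ij}=\partial^2\phi/\partial x^i\partial x^j$ in affine coordinates; $(M,\nabla,g)$ is then a Hessian manifold. A function $u:M\to\mathbb{R}$ is $g$-convex if it is continuous and, on every affine chart domain $U$ with convex image in $\mathbb{R}^n$ on which $g=\nabla d\phi$, the function $\phi+u$ is convex in the affine coordinates. $\mathcal{K}(M,g)$ is the set of all $g$-convex functions. *)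

theory Defs
  imports "HOL-Analysis.Analysis"
begin

section \<open>Smooth functions on open subsets of a normed space\<close>

text \<open>
  Both notions are only meant for open \<open>S\<close>: the derivatives are taken at points of the ambient space.
\<close>

fun Ck_on :: "nat \<Rightarrow> 'e::real_normed_vector set \<Rightarrow> ('e \<Rightarrow> 'f::real_normed_vector) \<Rightarrow> bool" where
  "Ck_on 0 S f \<longleftrightarrow> continuous_on S f"
| "Ck_on (Suc k) S f \<longleftrightarrow>
     (\<forall>x\<in>S. f differentiable (at x)) \<and>
     (\<forall>v. Ck_on k S (\<lambda>x. frechet_derivative f (at x) v))"

definition smooth_on :: "'e::real_normed_vector set \<Rightarrow> ('e \<Rightarrow> 'f::real_normed_vector) \<Rightarrow> bool" where
  "smooth_on S f \<longleftrightarrow> (\<forall>k. Ck_on k S f)"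

definition partial_deriv :: "'n \<Rightarrow> (real^'n \<Rightarrow> real) \<Rightarrow> real^'n::finite \<Rightarrow> real" where
  "partial_deriv i f x = frechet_derivative f (at x) (axis i 1)"


section \<open>Affine manifolds\<close>

text \<open>
  The manifold is a whole type, Hausdorff and second countable. A chart is a pair \<open>(U, x)\<close> of its
  domain and its coordinate map, whose values outside \<open>U\<close> are irrelevant. The flat torsion-free
  connection is given by an atlas with locally affine transition maps; its affine charts are
  those of the maximal such atlas.
\<close>

type_synonym ('a, 'n) chart = "'a set \<times> ('a \<Rightarrow> real^'n)"

definition is_chart :: "('a::topological_space, 'n::finite) chart \<Rightarrow> bool" where
  "is_chart = (\<lambda>(U, x). open U \<and> open (x ` U) \<and> (\<exists>x'. homeomorphism U (x ` U) x x'))"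

definition chart_inv :: "('a, 'n::finite) chart \<Rightarrow> real^'n \<Rightarrow> 'a" where
  "chart_inv = (\<lambda>(U, x). the_inv_into U x)"

text \<open>
  The coordinate change from the first to the second chart is \<open>z \<mapsto> L z + b\<close> near \<open>p\<close>.
\<close>

definition affine_transition_at ::
  "('a::topological_space, 'n::finite) chart \<Rightarrow> ('a, 'n) chart \<Rightarrow> 'a \<Rightarrow> real^'n^'n \<Rightarrow> real^'n \<Rightarrow> bool" where
  "affine_transition_at = (\<lambda>(U, x) (V, y) p L b.
     \<exists>W. open W \<and> p \<in> W \<and> W \<subseteq> U \<inter> V \<and> (\<forall>q\<in>W. y q = L *v x q + b))"

definition affinely_compatible ::
  "('a::topological_space, 'n::finite) chart \<Rightarrow> ('a, 'n) chart \<Rightarrow> bool" where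
  "affinely_compatible c d \<longleftrightarrow> (\<forall>p \<in> fst c \<inter> fst d. \<exists>L b. affine_transition_at c d p L b)"

definition affine_atlas ::
  "('a::{t2_space, second_countable_topology}, 'n::finite) chart set \<Rightarrow> bool" where
  "affine_atlas \<A> \<longleftrightarrow>
     (\<forall>c\<in>\<A>. is_chart c) \<and> (\<Union>c\<in>\<A>. fst c) = UNIV \<and>
     (\<forall>c\<in>\<A>. \<forall>d\<in>\<A>. affinely_compatible c d)"

definition affine_charts ::
  "('a::topological_space, 'n::finite) chart set \<Rightarrow> ('a, 'n) chart set" where
  "affine_charts \<A> =
     {c. is_chart c \<and> (\<forall>d\<in>\<A>. affinely_compatible c d \<and> affinely_compatible d c)}"

definition smooth_in_chart ::
  "('a, 'n::finite) chart \<Rightarrow> ('a \<Rightarrow> 'f::real_normed_vector) \<Rightarrow> bool" where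
  "smooth_in_chart c f \<longleftrightarrow> smooth_on (snd c ` fst c) (f \<circ> chart_inv c)"

definition smooth_functions ::
  "('a::topological_space, 'n::finite) chart set \<Rightarrow> ('a \<Rightarrow> real) set" where
  "smooth_functions \<A> = {f. \<forall>c \<in> affine_charts \<A>. smooth_in_chart c f}"


section \<open>Hessian metrics\<close>

text \<open>
  A metric is given by its component matrices: \<open>g c p $ i $ j\<close> is \<open>g\<^sub>i\<^sub>j(p)\<close> in the affine
  chart \<open>c\<close>. The components in different charts are related by the transformation rule of a
  covariant 2-tensor. Values of \<open>g\<close> outside affine charts and their domains are irrelevant.
\<close>

type_synonym ('a, 'n) metric = "('a, 'n) chart \<Rightarrow> 'a \<Rightarrow> real^'n^'n"

definition riemannian_metric ::
  "('a::topological_space, 'n::finite) chart set \<Rightarrow> ('a, 'n) metric \<Rightarrow> bool" where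
  "riemannian_metric \<A> g \<longleftrightarrow>
     (\<forall>c \<in> affine_charts \<A>.
        smooth_in_chart c (g c) \<and>
        (\<forall>p \<in> fst c. transpose (g c p) = g c p \<and> (\<forall>v. v \<noteq> 0 \<longrightarrow> v \<bullet> (g c p *v v) > 0))) \<and>
     (\<forall>c \<in> affine_charts \<A>. \<forall>d \<in> affine_charts \<A>. \<forall>p \<in> fst c \<inter> fst d. \<forall>L b.
        affine_transition_at c d p L b \<longrightarrow> g c p = transpose L ** g d p ** L)"

text \<open>
  \<open>g = \<nabla>d\<phi>\<close> on the domain of the chart \<open>c\<close>; the values of \<open>\<phi>\<close> elsewhere are irrelevant.
\<close>

definition hessian_potential ::
  "('a, 'n::finite) metric \<Rightarrow> ('a, 'n) chart \<Rightarrow> ('a \<Rightarrow> real) \<Rightarrow> bool" where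
  "hessian_potential g c \<phi> \<longleftrightarrow>
     smooth_in_chart c \<phi> \<and>
     (\<forall>p \<in> fst c. \<forall>i j.
        g c p $ i $ j = partial_deriv i (partial_deriv j (\<phi> \<circ> chart_inv c)) (snd c p))"

definition hessian_metric ::
  "('a::topological_space, 'n::finite) chart set \<Rightarrow> ('a, 'n) metric \<Rightarrow> bool" where
  "hessian_metric \<A> g \<longleftrightarrow>
     riemannian_metric \<A> g \<and>
     (\<forall>p. \<exists>c \<in> affine_charts \<A>. p \<in> fst c \<and> (\<exists>\<phi>. hessian_potential g c \<phi>))"

definition hessian_manifold ::
  "('a::{t2_space, second_countable_topology}, 'n::finite) chart set \<Rightarrow> ('a, 'n) metric \<Rightarrow> bool" where
  "hessian_manifold \<A> g \<longleftrightarrow> affine_atlas \<A> \<and> hessian_metric \<A> g"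


section \<open>\<open>g\<close>-convex functions\<close>

definition g_convex_functions ::
  "('a::topological_space, 'n::finite) chart set \<Rightarrow> ('a, 'n) metric \<Rightarrow> ('a \<Rightarrow> real) set" where
  "g_convex_functions \<A> g =
     {u. continuous_on UNIV u \<and>
         (\<forall>c \<in> affine_charts \<A>. convex (snd c ` fst c) \<longrightarrow>
            (\<forall>\<phi>. hessian_potential g c \<phi> \<longrightarrow>
               convex_on (snd c ` fst c) ((\<lambda>p. \<phi> p + u p) \<circ> chart_inv c)))}"

end

theory Submission
  imports Defs
begin

text \<open>
  Fix \<open>0 < \<epsilon> < 1\<close> and put \<open>v = (1 - \<epsilon>) u\<close>. Near each point \<open>p\<close> there are a potential \<open>\<phi>\<close> and
  an affine \<open>\<ell> \<le> \<phi> + u\<close> that almost touches at \<open>p\<close>. The smooth local function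
  \<open>w = (1 - \<epsilon>) (\<ell> - \<phi>) - e |x - x(p)|\<^sup>2\<close> lies below \<open>v\<close>, almost touches it at \<open>p\<close>, is smaller than
  \<open>v - \<tau>\<close> away from \<open>p\<close>, and has Hessian at least \<open>- (1 - \<epsilon> / 2) g\<close> for small \<open>e\<close>. Compactness
  makes \<open>\<tau>\<close> uniform and leaves finitely many \<open>w\<^sub>i\<close>. They are glued to the smooth function
  \<open>f\<^sub>k = (1 / k) ln (\<Sum>\<^sub>i exp (k w\<^sub>i - 1 / T\<^sub>i))\<close>, where \<open>T\<^sub>i = r\<^sub>i\<^sup>2 - |x - z\<^sub>i|\<^sup>2\<close> and the \<open>i\<close>-th term is
  \<open>0\<close> where \<open>T\<^sub>i \<le> 0\<close>.
  By convexity of log-sum-exp, \<open>k \<cdot> Hess f\<^sub>k\<close> is at least the weighted mean of the Hessians of the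
  exponents. The Hessian of \<open>- 1 / T\<^sub>i\<close> is unbounded below only near the boundary of the \<open>i\<close>-th ball;
  there another term dominates, so its weighted contribution is bounded independently of \<open>k\<close>. After division
  by \<open>k\<close> it is absorbed by \<open>(\<epsilon> / 2) g\<close>, so that \<open>f\<^sub>k\<close> is \<open>g\<close>-convex for large \<open>k\<close>.
\<close>

section \<open>Calculus of functions with continuous derivatives\<close>

lemma Ck_on_cong:
  assumes "open S" "\<And>x. x \<in> S \<Longrightarrow> f x = g x" "Ck_on k S f"
  shows "Ck_on k S g"
  using assms(2,3)
proof (induction k arbitrary: f g)
  case 0
  then show ?case by (metis Ck_on.simps(1) continuous_on_cong)
next
  case (Suc k)
  have d: "(g has_derivative frechet_derivative f (at x)) (at x)" if "x \<in> S" for x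
  proof -
    have "(f has_derivative frechet_derivative f (at x)) (at x)"
      using Suc.prems(2) that by (simp add: frechet_derivative_works[symmetric])
    then show ?thesis
      by (rule has_derivative_transform_within_open[OF _ assms(1) that]) (rule Suc.prems(1))
  qed
  have eq: "frechet_derivative f (at x) v = frechet_derivative g (at x) v" if "x \<in> S" for x v
    using frechet_derivative_at[OF d[OF that]] by simp
  have "Ck_on k S (\<lambda>x. frechet_derivative g (at x) v)" for v
    by (rule Suc.IH[OF eq]) (use Suc.prems(2) in simp_all)
  then show ?case using d by (auto simp: differentiable_def)
qed

text \<open>Uniqueness of the derivative at points of an open set lets
  \<open>frechet_derivative\<close> be replaced by an explicit formula \<open>f'\<close>; the
  differentiation rules below go through this lemma.\<close>

lemma Ck_on_SucI:
  assumes "open S" "\<And>x. x \<in> S \<Longrightarrow> (f has_derivative f' x) (at x)"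
    and "\<And>v. Ck_on k S (\<lambda>x. f' x v)"
  shows "Ck_on (Suc k) S f"
proof -
  have "f' x v = frechet_derivative f (at x) v" if "x \<in> S" for x v
    using frechet_derivative_at[OF assms(2)[OF that]] by simp
  then have "Ck_on k S (\<lambda>x. frechet_derivative f (at x) v)" for v
    by (rule Ck_on_cong[OF assms(1) _ assms(3)])
  then show ?thesis using assms(2) by (auto simp: differentiable_def)
qed

lemma Ck_on_Suc_imp: "Ck_on (Suc k) S f \<Longrightarrow> Ck_on k S f"
proof (induction k arbitrary: f)
  case 0
  then show ?case
    by (auto intro!: continuous_at_imp_continuous_on differentiable_imp_continuous_within)
next
  case (Suc k)
  have "Ck_on k S (\<lambda>x. frechet_derivative f (at x) v)" for v
    using Suc.prems by (intro Suc.IH) (simp only: Ck_on.simps(2)[of "Suc k"])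
  then show ?case using Suc.prems by (simp only: Ck_on.simps) blast
qed

lemma Ck_on_subset: "Ck_on k T f \<Longrightarrow> S \<subseteq> T \<Longrightarrow> Ck_on k S f"
  by (induction k arbitrary: f) (auto intro: continuous_on_subset)

text \<open>Continuity and differentiability are local, and so is each iterated derivative. This
  serves the bump terms, which are given by different formulas near different points of a
  chart.\<close>

lemma Ck_on_local:
  assumes "\<And>x. x \<in> S \<Longrightarrow> \<exists>N. open N \<and> x \<in> N \<and> Ck_on k N f"
  shows "Ck_on k S f"
  using assms
proof (induction k arbitrary: f)
  case 0
  then show ?case
    by (metis Ck_on.simps(1) continuous_at_imp_continuous_on continuous_on_eq_continuous_at)
next
  case (Suc k)
  have "Ck_on k S (\<lambda>x. frechet_derivative f (at x) v)" for v
    by (rule Suc.IH) (use Suc.prems in \<open>force simp only: Ck_on.simps\<close>)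
  moreover have "f differentiable (at x)" if "x \<in> S" for x
    using Suc.prems[OF that] by (force simp only: Ck_on.simps)
  ultimately show ?case by (simp only: Ck_on.simps) blast
qed

lemma Ck_on_const: "open S \<Longrightarrow> Ck_on k S (\<lambda>x. c)"
proof (induction k arbitrary: c)
  case (Suc k)
  then show ?case by (intro Ck_on_SucI[where f' = "\<lambda>_ _. 0"]) auto
qed simp

lemma Ck_on_bounded_linear:
  assumes "open S" "bounded_linear f"
  shows "Ck_on k S f"
proof (cases k)
  case 0
  then show ?thesis using assms by (simp add: linear_continuous_on)
next
  case (Suc m)
  show ?thesis unfolding Suc using assms
    by (intro Ck_on_SucI[where f' = "\<lambda>_. f"] Ck_on_const bounded_linear_imp_has_derivative)
qed

lemma Ck_on_add:
  assumes "open S" "Ck_on k S f" "Ck_on k S g"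
  shows "Ck_on k S (\<lambda>x. f x + g x)"
  using assms(2,3)
proof (induction k arbitrary: f g)
  case 0
  then show ?case by (auto intro: continuous_intros)
next
  case (Suc k)
  show ?case
  proof (rule Ck_on_SucI[OF assms(1)])
    show "((\<lambda>x. f x + g x) has_derivative
      (\<lambda>v. frechet_derivative f (at x) v + frechet_derivative g (at x) v)) (at x)" if "x \<in> S" for x
      using Suc.prems that by (auto intro!: has_derivative_add simp: frechet_derivative_works[symmetric])
  qed (use Suc in auto)
qed

lemma Ck_on_sum:
  assumes "open S" "\<And>i. i \<in> I \<Longrightarrow> Ck_on k S (f i)"
  shows "Ck_on k S (\<lambda>x. \<Sum>i\<in>I. f i x)"
proof (cases "finite I")
  case True
  then show ?thesis using assms(2)
    by (induction I) (auto intro!: Ck_on_add Ck_on_const assms(1))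
qed (simp add: Ck_on_const assms(1))

lemma Ck_on_mult:
  fixes f g :: "'e::real_normed_vector \<Rightarrow> real"
  assumes "open S" "Ck_on k S f" "Ck_on k S g"
  shows "Ck_on k S (\<lambda>x. f x * g x)"
  using assms(2,3)
proof (induction k arbitrary: f g)
  case 0
  then show ?case by (auto intro: continuous_intros)
next
  case (Suc k)
  show ?case
  proof (rule Ck_on_SucI[OF assms(1)])
    show "((\<lambda>x. f x * g x) has_derivative
      (\<lambda>v. f x * frechet_derivative g (at x) v + frechet_derivative f (at x) v * g x)) (at x)"
      if "x \<in> S" for x
      using Suc.prems that by (auto intro!: has_derivative_mult simp: frechet_derivative_works[symmetric])
    show "Ck_on k S (\<lambda>x. f x * frechet_derivative g (at x) v + frechet_derivative f (at x) v * g x)" for v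
      using Suc.prems Suc.prems[THEN Ck_on_Suc_imp] by (intro Ck_on_add assms(1) Suc.IH) auto
  qed
qed

text \<open>The derivative is \<open>h' (f x)\<close> times the derivative of \<open>f\<close>. The
  induction hypothesis for \<open>h'\<close> with the same \<open>f\<close> covers the first factor,
  so only \<open>h\<close> is generalized.\<close>

lemma Ck_on_compose_real:
  fixes f :: "'e::real_normed_vector \<Rightarrow> real" and h :: "real \<Rightarrow> real"
  assumes "open S" "open T" "f ` S \<subseteq> T" "Ck_on k T h" "Ck_on k S f"
  shows "Ck_on k S (\<lambda>x. h (f x))"
  using assms(4,5)
proof (induction k arbitrary: h)
  case 0
  then show ?case using assms(3) by (auto intro: continuous_on_compose2)
next
  case (Suc k)
  \<comment> \<open>A linear map on the reals is multiplication by its value at \<open>1\<close>, so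
    the Frechet derivative of \<open>h\<close> becomes an ordinary derivative.\<close>
  define h' where "h' = (\<lambda>t. frechet_derivative h (at t) 1)"
  have h': "(h has_real_derivative h' t) (at t)" if "t \<in> T" for t
  proof -
    have d: "(h has_derivative frechet_derivative h (at t)) (at t)"
      using Suc.prems(1) that by (simp add: frechet_derivative_works[symmetric])
    then interpret linear "frechet_derivative h (at t)" by (rule has_derivative_linear)
    have "frechet_derivative h (at t) = (*) (h' t)"
    proof
      show "frechet_derivative h (at t) r = h' t * r" for r
        using scaleR[of r 1] unfolding h'_def by (metis real_scaleR_def mult.right_neutral mult.commute)
    qed
    then show ?thesis using d by (simp add: has_field_derivative_def)
  qed
  show ?case
  proof (rule Ck_on_SucI[OF assms(1)])
    show "((\<lambda>x. h (f x)) has_derivative (\<lambda>v. h' (f x) * frechet_derivative f (at x) v)) (at x)"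
      if "x \<in> S" for x
    proof -
      have "(f has_derivative frechet_derivative f (at x)) (at x)"
        using Suc.prems(2) that by (simp add: frechet_derivative_works[symmetric])
      moreover have "(h has_derivative (*) (h' (f x))) (at (f x))"
        using h'[of "f x"] that assms(3) by (auto simp: has_field_derivative_def)
      ultimately show ?thesis by (rule has_derivative_compose)
    qed
    show "Ck_on k S (\<lambda>x. h' (f x) * frechet_derivative f (at x) v)" for v
    proof (rule Ck_on_mult[OF assms(1)])
      show "Ck_on k S (\<lambda>x. h' (f x))"
        by (rule Suc.IH) (use Suc.prems Ck_on_Suc_imp[OF Suc.prems(2)] in \<open>simp_all add: h'_def\<close>)
    qed (use Suc.prems in simp)
  qed
qed

text \<open>The derivative in direction \<open>v\<close> is that of \<open>f\<close> in direction
  \<open>L v\<close>, composed with the same affine map, so the induction closes without a product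
  rule. Changes between affine charts have this form locally.\<close>

lemma Ck_on_compose_affine:
  assumes "open S" "bounded_linear L" "Ck_on k T f" "\<And>x. x \<in> S \<Longrightarrow> L x + b \<in> T"
  shows "Ck_on k S (\<lambda>x. f (L x + b))"
  using assms(3)
proof (induction k arbitrary: f)
  case 0
  have "continuous_on S (\<lambda>x. L x + b)"
    using assms(2) by (intro continuous_intros linear_continuous_on)
  then show ?case using 0 assms(4) by (auto intro: continuous_on_compose2)
next
  case (Suc k)
  show ?case
  proof (rule Ck_on_SucI[OF assms(1)])
    show "((\<lambda>x. f (L x + b)) has_derivative (\<lambda>v. frechet_derivative f (at (L x + b)) (L v))) (at x)"
      if "x \<in> S" for x
    proof -
      have "((\<lambda>x. L x + b) has_derivative L) (at x)"
        using assms(2) by (auto intro!: derivative_eq_intros bounded_linear_imp_has_derivative)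
      moreover have "(f has_derivative frechet_derivative f (at (L x + b))) (at (L x + b))"
        using Suc.prems assms(4)[OF that] by (simp add: frechet_derivative_works[symmetric])
      ultimately show ?thesis by (rule has_derivative_compose)
    qed
  qed (use Suc in auto)
qed

section \<open>Smooth functions of one variable: exponential, inverse, logarithm, flat
  functions\<close>

lemma Ck_on_real:
  fixes h h' :: "real \<Rightarrow> real"
  assumes "open S" "\<And>t. t \<in> S \<Longrightarrow> (h has_real_derivative h' t) (at t)" "Ck_on k S h'"
  shows "Ck_on (Suc k) S h"
proof (rule Ck_on_SucI[OF assms(1)])
  show "(h has_derivative (\<lambda>v. h' t * v)) (at t)" if "t \<in> S" for t
    using assms(2)[OF that] by (simp add: has_field_derivative_def)
qed (intro Ck_on_mult assms(1,3) Ck_on_const)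

lemma Ck_on_exp: "Ck_on k UNIV (exp :: real \<Rightarrow> real)"
  by (induction k) (auto intro!: continuous_intros Ck_on_real[where h' = exp] derivative_eq_intros simp del: Ck_on.simps(2))

lemma Ck_on_inverse: "Ck_on k {0<..} (inverse :: real \<Rightarrow> real)"
proof (induction k)
  case (Suc k)
  show ?case
  proof (rule Ck_on_real)
    show "Ck_on k {0<..} (\<lambda>t::real. - 1 * (inverse t * inverse t))"
      by (intro Ck_on_mult Ck_on_const Suc) auto
  qed (auto intro!: derivative_eq_intros)
qed (auto intro!: continuous_intros)

lemma Ck_on_ln: "Ck_on k {0<..} (ln :: real \<Rightarrow> real)"
proof (cases k)
  case (Suc m)
  have "Ck_on (Suc m) {0<..} (ln :: real \<Rightarrow> real)"
    by (rule Ck_on_real[OF _ _ Ck_on_inverse]) (auto intro!: derivative_eq_intros simp: field_simps)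
  then show ?thesis by (simp add: Suc)
qed (auto intro!: continuous_intros)

text \<open>The power of \<open>t\<close> makes the family closed under differentiation.\<close>

definition flat :: "nat \<Rightarrow> real \<Rightarrow> real" where
  "flat m t = (if 0 < t then exp (- 1 / t) / t ^ m else 0)"

text \<open>A single term of the power series of \<open>exp (1 / t)\<close> is below the whole sum;
  multiplying by \<open>exp (- 1 / t)\<close> turns this into the bound.\<close>

lemma exp_neg_inverse_le:
  assumes "0 < (t::real)"
  shows "exp (- 1 / t) \<le> fact m * t ^ m"
proof -
  have "(1 / t) ^ m /\<^sub>R fact m \<le> exp (1 / t)"
    unfolding exp_def
    using sum_le_suminf[OF summable_exp_generic[of "1/t"], of "{m}"] assms by auto
  then have "1 \<le> exp (1 / t) * (fact m * t ^ m)"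
    using assms by (auto simp: field_simps power_divide)
  then have "exp (- (1 / t)) * 1 \<le> exp (- (1 / t)) * (exp (1 / t) * (fact m * t ^ m))"
    by (intro mult_left_mono) auto
  also have "\<dots> = exp (- (1/t) + 1/t) * (fact m * t ^ m)"
    by (simp only: exp_add mult.assoc)
  finally show ?thesis by simp
qed

lemma flat_nonneg: "0 \<le> flat m t" 
  by (auto simp: flat_def)

text \<open>Of the \<open>m + j\<close> powers of \<open>t\<close> supplied by
  \<open>exp_neg_inverse_le\<close>, \<open>m\<close> cancel the denominator. The case
  \<open>j = 2\<close> serves the derivative at \<open>0\<close>, the case \<open>j = 0\<close>
  gives a uniform bound.\<close>

lemma flat_le: "0 \<le> t \<Longrightarrow> flat m t \<le> fact (m + j) * t ^ j"
  using exp_neg_inverse_le[of t "m + j"]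
  by (auto simp: flat_def field_simps power_add)

lemma flat_le_fact: "flat m t \<le> fact m"
  using flat_le[of t m 0] by (cases "0 < t") (auto simp: flat_def)

text \<open>For positive \<open>t\<close> this is the quotient rule, and for negative
  \<open>t\<close> the function is locally \<open>0\<close>. At \<open>0\<close> a quadratic bound
  on \<open>flat m\<close> makes the difference quotient tend to \<open>0\<close>.\<close>

lemma has_derivative_flat:
  "(flat m has_real_derivative flat (m + 2) t - real m * flat (m + 1) t) (at t)"
proof (cases t "0::real" rule: linorder_cases)
  case greater
  have "((\<lambda>t. exp (- 1 / t) / t ^ m) has_real_derivative flat (m + 2) t - real m * flat (m + 1) t) (at t)"
  proof (cases m)
    case (Suc j)
    have "((\<lambda>t. t ^ Suc j) has_real_derivative real (Suc j) * t ^ j) (at t)"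
      using DERIV_pow[of "Suc j"] by simp
    moreover have "((\<lambda>t. exp (- 1 / t)) has_real_derivative exp (- 1 / t) / t\<^sup>2) (at t)"
      using greater by (auto intro!: derivative_eq_intros simp: power2_eq_square)
    ultimately have "((\<lambda>t. exp (- 1 / t) / t ^ Suc j) has_real_derivative
        (exp (- 1 / t) / t\<^sup>2 * t ^ Suc j - exp (- 1 / t) * (real (Suc j) * t ^ j)) / (t ^ Suc j * t ^ Suc j)) (at t)"
      using greater by (intro DERIV_divide) auto
    moreover have "(exp (- 1 / t) / t\<^sup>2 * t ^ Suc j - exp (- 1 / t) * (real (Suc j) * t ^ j)) / (t ^ Suc j * t ^ Suc j)
      = flat (m + 2) t - real m * flat (m + 1) t"
      unfolding Suc using greater by (simp add: flat_def field_simps power2_eq_square)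
    ultimately show ?thesis by (simp only: Suc)
  qed (use greater in \<open>auto intro!: derivative_eq_intros simp: flat_def field_simps power2_eq_square\<close>)
  moreover have "exp (- 1 / s) / s ^ m = flat m s" if "s \<in> {0<..}" for s
    using that by (simp add: flat_def)
  ultimately show ?thesis
    using has_field_derivative_transform_within_open[of _ _ t "{0<..}" "flat m"] greater by auto
next
  case less
  have "((\<lambda>t. 0) has_real_derivative flat (m + 2) t - real m * flat (m + 1) t) (at t)"
    using less by (auto simp: flat_def)
  moreover have "0 = flat m s" if "s \<in> {..<0}" for s
    using that by (simp add: flat_def)
  ultimately show ?thesis
    using has_field_derivative_transform_within_open[of _ _ t "{..<0}" "flat m"] less by auto
next
  case equal
  have "((\<lambda>h. flat m h / h) \<longlongrightarrow> 0) (at 0)"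
  proof (rule Lim_null_comparison)
    have "norm (flat m h / h) \<le> fact (m + 2) * \<bar>h\<bar>" if "h \<noteq> 0" for h
    proof (cases "0 < h")
      case True
      then show ?thesis using flat_le[of h m 2] flat_nonneg[of m h]
        by (simp add: field_simps power2_eq_square)
    next
      case False
      then have "norm (flat m h / h) = 0" by (simp add: flat_def)
      also have "0 \<le> fact (m + 2) * \<bar>h\<bar>" by (intro mult_nonneg_nonneg) auto
      finally show ?thesis .
    qed
    then show "\<forall>\<^sub>F h in at 0. norm (flat m h / h) \<le> fact (m + 2) * \<bar>h\<bar>"
      by (simp add: eventually_at_filter)
    show "((\<lambda>h::real. fact (m + 2) * \<bar>h\<bar>) \<longlongrightarrow> 0) (at 0)"
      by (auto intro!: tendsto_eq_intros)
  qed
  then show ?thesis using equal by (simp add: DERIV_def flat_def)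
qed

lemma Ck_on_flat: "Ck_on k UNIV (flat m)"
proof (induction k arbitrary: m)
  case 0
  show ?case
    using has_derivative_flat[THEN DERIV_isCont] by (auto intro!: continuous_at_imp_continuous_on)
next
  case (Suc k)
  show ?case
  proof (rule Ck_on_real)
    show "Ck_on k UNIV (\<lambda>t. flat (m + 2) t + (- real m) * flat (m + 1) t)"
      by (intro Ck_on_add Ck_on_mult Ck_on_const Suc) auto
  qed (use has_derivative_flat in auto)
qed

text \<open>In coordinates this is a quadratic polynomial, so the rules for sums, products and
  linear maps suffice.\<close>

lemma Ck_on_norm_diff_sq: "Ck_on k UNIV (\<lambda>z::real^'n::finite. (norm (z - p))\<^sup>2)"
proof -
  have "Ck_on k UNIV (\<lambda>z::real^'n. \<Sum>i\<in>UNIV. (z $ i + (- p $ i)) * (z $ i + (- p $ i)))"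
    by (intro Ck_on_sum Ck_on_mult Ck_on_add Ck_on_const Ck_on_bounded_linear bounded_linear_vec_nth) auto
  then show ?thesis
    by (simp add: power2_norm_eq_inner inner_vec_def)
qed

section \<open>Second derivatives along lines\<close>

text \<open>\<open>a\<close> and \<open>b\<close> are the first and second derivatives at
  \<open>t\<close>. The function \<open>F'\<close> has to be the derivative only near
  \<open>t\<close>, so the notion depends on the germ of \<open>F\<close> alone.\<close>

definition has_d2 :: "(real \<Rightarrow> real) \<Rightarrow> real \<Rightarrow> real \<Rightarrow> real \<Rightarrow> bool" where
  "has_d2 F t a b \<longleftrightarrow> (\<exists>F'. (\<forall>\<^sub>F s in nhds t. (F has_real_derivative F' s) (at s)) \<and> F' t = a \<and>
     (F' has_real_derivative b) (at t))"

lemma has_d2I: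
  "\<forall>\<^sub>F s in nhds t. (F has_real_derivative F' s) (at s) \<Longrightarrow> F' t = a \<Longrightarrow>
    (F' has_real_derivative b) (at t) \<Longrightarrow> has_d2 F t a b"
  by (auto simp: has_d2_def)

lemma has_d2_DERIV: "has_d2 F t a b \<Longrightarrow> (F has_real_derivative a) (at t)"
  by (auto simp: has_d2_def dest: eventually_nhds_x_imp_x)

lemma has_d2_DERIV_deriv: 
  assumes "has_d2 F t a b" 
  shows "(deriv F has_real_derivative b) (at t)"
proof -
  obtain F' where F': "\<forall>\<^sub>F s in nhds t. (F has_real_derivative F' s) (at s)"
    "(F' has_real_derivative b) (at t)"
    using assms by (auto simp: has_d2_def)
  have "\<forall>\<^sub>F s in nhds t. F' s = deriv F s"
    using F'(1) by eventually_elim (metis DERIV_imp_deriv)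
  then show ?thesis using F'(2) DERIV_cong_ev[OF refl _ refl] by blast
qed

lemma has_d2_cong:
  assumes "\<forall>\<^sub>F s in nhds t. F s = G s" "has_d2 F t a b"
  shows "has_d2 G t a b"
proof -
  obtain F' where F': "\<forall>\<^sub>F s in nhds t. (F has_real_derivative F' s) (at s)" "F' t = a"
    "(F' has_real_derivative b) (at t)"
    using assms(2) by (auto simp: has_d2_def)
  have "\<forall>\<^sub>F s in nhds t. \<forall>\<^sub>F s' in nhds s. F s' = G s'"
    using assms(1) by (simp add: eventually_eventually)
  with F'(1) have "\<forall>\<^sub>F s in nhds t. (G has_real_derivative F' s) (at s)"
    by eventually_elim (metis DERIV_cong_ev)
  then show ?thesis using F' by (auto intro: has_d2I)
qed

lemma has_d2_const: "has_d2 (\<lambda>s. c) t 0 0"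
  by (rule has_d2I[where F' = "\<lambda>s. 0"]) auto

lemma has_d2_add:
  assumes "has_d2 F t a b" "has_d2 G t a' b'"
  shows "has_d2 (\<lambda>s. F s + G s) t (a + a') (b + b')"
proof -
  obtain F' where F': "\<forall>\<^sub>F s in nhds t. (F has_real_derivative F' s) (at s)" "F' t = a"
    "(F' has_real_derivative b) (at t)"
    using assms(1) by (auto simp: has_d2_def)
  obtain G' where G': "\<forall>\<^sub>F s in nhds t. (G has_real_derivative G' s) (at s)" "G' t = a'"
    "(G' has_real_derivative b') (at t)"
    using assms(2) by (auto simp: has_d2_def)
  show ?thesis
  proof (rule has_d2I)
    show "\<forall>\<^sub>F s in nhds t. ((\<lambda>s. F s + G s) has_real_derivative F' s + G' s) (at s)"
      using F'(1) G'(1) by eventually_elim (rule DERIV_add)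
  qed (use F' G' in \<open>auto intro: DERIV_add\<close>)
qed

lemma has_d2_mult:
  assumes "has_d2 F t a b" "has_d2 G t a' b'"
  shows "has_d2 (\<lambda>s. F s * G s) t (a * G t + F t * a') (b * G t + 2 * a * a' + F t * b')"
proof -
  obtain F' where F': "\<forall>\<^sub>F s in nhds t. (F has_real_derivative F' s) (at s)" "F' t = a"
    "(F' has_real_derivative b) (at t)"
    using assms(1) by (auto simp: has_d2_def)
  obtain G' where G': "\<forall>\<^sub>F s in nhds t. (G has_real_derivative G' s) (at s)" "G' t = a'"
    "(G' has_real_derivative b') (at t)"
    using assms(2) by (auto simp: has_d2_def)
  show ?thesis
  proof (rule has_d2I)
    show "\<forall>\<^sub>F s in nhds t. ((\<lambda>s. F s * G s) has_real_derivative F' s * G s + F s * G' s) (at s)"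
      using F'(1) G'(1) by eventually_elim (auto intro!: derivative_eq_intros)
    show "((\<lambda>s. F' s * G s + F s * G' s) has_real_derivative b * G t + 2 * a * a' + F t * b') (at t)"
      using F' G' eventually_nhds_x_imp_x[OF F'(1)] eventually_nhds_x_imp_x[OF G'(1)]
      by (auto intro!: derivative_eq_intros)
  qed (use F' G' in auto)
qed

lemma has_d2_cmult: "has_d2 F t a b \<Longrightarrow> has_d2 (\<lambda>s. c * F s) t (c * a) (c * b)"
  using has_d2_mult[OF has_d2_const[of c]] by fastforce

lemma has_d2_sum:
  "(\<And>i. i \<in> I \<Longrightarrow> has_d2 (F i) t (a i) (b i)) \<Longrightarrow>
    has_d2 (\<lambda>s. \<Sum>i\<in>I. F i s) t (\<Sum>i\<in>I. a i) (\<Sum>i\<in>I. b i)"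
  by (induction I rule: infinite_finite_induct) (auto intro!: has_d2_const has_d2_add)

text \<open>Continuity of \<open>F\<close> at \<open>t\<close> keeps \<open>F s\<close> where
  \<open>h'\<close> is the derivative of \<open>h\<close>, so the chain rule holds near
  \<open>t\<close> and its result can be differentiated once more.\<close>

lemma has_d2_compose:
  assumes "\<forall>\<^sub>F y in nhds (F t). (h has_real_derivative h' y) (at y)"
    and "(h' has_real_derivative c) (at (F t))" "has_d2 F t a b"
  shows "has_d2 (\<lambda>s. h (F s)) t (h' (F t) * a) (c * a\<^sup>2 + h' (F t) * b)"
proof -
  obtain F' where F': "\<forall>\<^sub>F s in nhds t. (F has_real_derivative F' s) (at s)" "F' t = a"
    "(F' has_real_derivative b) (at t)"
    using assms(3) by (auto simp: has_d2_def)
  have F: "(F has_real_derivative a) (at t)" using assms(3) by (rule has_d2_DERIV)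
  have "filterlim F (nhds (F t)) (nhds t)"
    using DERIV_isCont[OF F] by (simp add: isCont_def tendsto_at_iff_tendsto_nhds)
  then have ev: "\<forall>\<^sub>F s in nhds t. (h has_real_derivative h' (F s)) (at (F s))"
    using assms(1) by (auto simp: filterlim_iff)
  show ?thesis
  proof (rule has_d2I)
    show "\<forall>\<^sub>F s in nhds t. ((\<lambda>s. h (F s)) has_real_derivative h' (F s) * F' s) (at s)"
      using ev F'(1) by eventually_elim (rule DERIV_chain2)
    have "((\<lambda>s. h' (F s)) has_real_derivative c * a) (at t)"
      using DERIV_chain2[OF assms(2) F] .
    then show "((\<lambda>s. h' (F s) * F' s) has_real_derivative c * a\<^sup>2 + h' (F t) * b) (at t)"
      using F'(2,3) by (auto intro!: derivative_eq_intros simp: power2_eq_square)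
  qed (use F' in auto)
qed

text \<open>Composition with a translation moves the base point. Derivatives along lines are
  computed at parameter \<open>0\<close>, whereas the convexity test needs them all along a
  segment.\<close>

lemma has_d2_shift:
  assumes "has_d2 (\<lambda>s. F (t + s)) 0 a b"
  shows "has_d2 F t a b"
proof -
  have "has_d2 (\<lambda>s. s - t) t 1 0"
    by (rule has_d2I[where F' = "\<lambda>_. 1"]) (auto intro!: derivative_eq_intros always_eventually)
  moreover obtain G' where G': "\<forall>\<^sub>F s in nhds 0. ((\<lambda>s. F (t + s)) has_real_derivative G' s) (at s)"
    "G' 0 = a" "(G' has_real_derivative b) (at 0)"
    using assms by (auto simp: has_d2_def)
  ultimately have "has_d2 (\<lambda>s. F (t + (s - t))) t (G' (t - t) * 1) (b * 1\<^sup>2 + G' (t - t) * 0)"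
    by (intro has_d2_compose[where h = "\<lambda>s. F (t + s)" and F = "\<lambda>s. s - t"]) auto
  then show ?thesis using G'(2) by simp
qed

text \<open>The quadratic form of the Hessian of \<open>f\<close> at \<open>z\<close>, evaluated at
  \<open>v\<close>; convexity and all Hessian bounds below are expressed through it.\<close>

definition second_deriv :: "('e::real_normed_vector \<Rightarrow> real) \<Rightarrow> 'e \<Rightarrow> 'e \<Rightarrow> real" where
  "second_deriv f z v = frechet_derivative (\<lambda>y. frechet_derivative f (at y) v) (at z) v"

lemma eventually_line_mem:
  fixes z v :: "'e::real_normed_vector"
  assumes "open N" "z \<in> N"
  shows "\<forall>\<^sub>F s in nhds 0. z + s *\<^sub>R v \<in> N"
proof -
  have "filterlim (\<lambda>s. z + s *\<^sub>R v) (nhds z) (nhds 0)"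
    by (auto intro!: tendsto_eq_intros filterlim_ident)
  then show ?thesis using eventually_nhds_in_open[OF assms] by (auto simp: filterlim_iff)
qed

lemma has_d2_line:
  fixes z v :: "'e::real_normed_vector"
  assumes "open S" "Ck_on (Suc (Suc k)) S f" "z \<in> S"
  shows "has_d2 (\<lambda>s. f (z + s *\<^sub>R v)) 0 (frechet_derivative f (at z) v) (second_deriv f z v)"
proof -
  have line: "((\<lambda>s. h (z + s *\<^sub>R v)) has_real_derivative frechet_derivative h (at (z + s *\<^sub>R v)) v) (at s)"
    if "h differentiable (at (z + s *\<^sub>R v))" for h :: "'e \<Rightarrow> real" and s
  proof -
    have d: "(h has_derivative frechet_derivative h (at (z + s *\<^sub>R v))) (at (z + s *\<^sub>R v))"
      using that by (simp add: frechet_derivative_works[symmetric])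
    have "((\<lambda>s. h (z + s *\<^sub>R v)) has_derivative (\<lambda>r. frechet_derivative h (at (z + s *\<^sub>R v)) (r *\<^sub>R v))) (at s)"
      by (rule has_derivative_compose[where f = "\<lambda>s. z + s *\<^sub>R v", OF _ d]) (auto intro!: derivative_eq_intros)
    then show ?thesis
      using linear_scale[OF has_derivative_linear[OF d]]
      by (simp add: has_field_derivative_def mult_commute_abs)
  qed
  show ?thesis
  proof (rule has_d2I)
    show "\<forall>\<^sub>F s in nhds 0. ((\<lambda>s. f (z + s *\<^sub>R v)) has_real_derivative
        frechet_derivative f (at (z + s *\<^sub>R v)) v) (at s)"
      using eventually_line_mem[OF assms(1,3)]
      by eventually_elim (rule line, use assms(2) in auto)
    have "(\<lambda>y. frechet_derivative f (at y) v) differentiable (at z)"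
      using assms(2,3) by simp
    then show "((\<lambda>s. frechet_derivative f (at (z + s *\<^sub>R v)) v) has_real_derivative second_deriv f z v) (at 0)"
      using line[of "\<lambda>y. frechet_derivative f (at y) v" 0] by (simp add: second_deriv_def)
  qed simp
qed

lemma has_d2_norm_sq_line:
  fixes z v p :: "'e::real_inner"
  shows "has_d2 (\<lambda>s. (norm (z + s *\<^sub>R v - p))\<^sup>2) 0 (2 * ((z - p) \<bullet> v)) (2 * (norm v)\<^sup>2)"
proof -
  have "(norm (z + s *\<^sub>R v - p))\<^sup>2 = (norm (z - p))\<^sup>2 + 2 * ((z - p) \<bullet> v) * s + (norm v)\<^sup>2 * s\<^sup>2" for s
    unfolding power2_norm_eq_inner
    by (simp add: algebra_simps inner_simps inner_commute power2_eq_square)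
  then show ?thesis
    by (auto intro!: has_d2I[where F' = "\<lambda>s. 2 * ((z - p) \<bullet> v) + (norm v)\<^sup>2 * (2 * s)"]
        always_eventually derivative_eq_intros)
qed

text \<open>Restrict \<open>F\<close> to a segment from \<open>x\<close> to \<open>y\<close>. The
  hypothesis at each of its points, in direction \<open>y - x\<close>, makes the second derivative
  of the restriction nonnegative, and the criterion in one variable applies.\<close>

lemma convex_on_has_d2:
  fixes F :: "'e::real_normed_vector \<Rightarrow> real"
  assumes "convex S"
    and d2: "\<And>z v. z \<in> S \<Longrightarrow> \<exists>a b. has_d2 (\<lambda>s. F (z + s *\<^sub>R v)) 0 a b \<and> 0 \<le> b"
  shows "convex_on S F"
proof (rule convex_onI)
  fix t :: real and x y assume t: "0 < t" "t < 1" and xy: "x \<in> S" "y \<in> S"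
  define G where "G s = F (x + s *\<^sub>R (y - x))" for s
  have "\<exists>a b. has_d2 G s a b \<and> 0 \<le> b" if "s \<in> {0..1}" for s
  proof -
    have "x + s *\<^sub>R (y - x) = (1 - s) *\<^sub>R x + s *\<^sub>R y" by (simp add: algebra_simps)
    then have "x + s *\<^sub>R (y - x) \<in> S" using assms(1) xy that by (auto intro!: convexD)
    from d2[OF this, of "y - x"] obtain a b where
      "has_d2 (\<lambda>r. F (x + s *\<^sub>R (y - x) + r *\<^sub>R (y - x))) 0 a b" "0 \<le> b" by blast
    moreover have "x + s *\<^sub>R (y - x) + r *\<^sub>R (y - x) = x + (s + r) *\<^sub>R (y - x)" for r
      by (simp add: algebra_simps)
    ultimately show ?thesis unfolding G_def by (auto intro: has_d2_shift)
  qed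
  then obtain a b where ab: "\<And>s. s \<in> {0..1} \<Longrightarrow> has_d2 G s (a s) (b s)" "\<And>s. s \<in> {0..1} \<Longrightarrow> 0 \<le> b s"
    by metis
  have "convex_on {0..1} G"
  proof (rule f''_ge0_imp_convex)
    show "(G has_real_derivative deriv G s) (at s)" if "s \<in> {0..1}" for s
      using has_d2_DERIV[OF ab(1)[OF that]] by (simp add: DERIV_imp_deriv)
    show "(deriv G has_real_derivative b s) (at s)" if "s \<in> {0..1}" for s
      using has_d2_DERIV_deriv[OF ab(1)[OF that]] .
  qed (use ab(2) in auto)
  then have "G ((1 - t) *\<^sub>R 0 + t *\<^sub>R 1) \<le> (1 - t) * G 0 + t * G 1"
    using t by (intro convex_onD) auto
  moreover have "x + t *\<^sub>R (y - x) = (1 - t) *\<^sub>R x + t *\<^sub>R y" by (simp add: algebra_simps)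
  ultimately show "F ((1 - t) *\<^sub>R x + t *\<^sub>R y) \<le> (1 - t) * F x + t * F y"
    by (simp add: G_def)
qed (use assms in auto)

section \<open>Second derivatives of log-sum-exp and of its terms\<close>

text \<open>\<open>\<beta> i\<close> bounds minus the second derivative of \<open>ln (H i)\<close>,
  in a form multiplied by \<open>H i t\<close> that makes sense where a term vanishes.
  Cauchy-Schwarz bounds the negative term \<open>(\<Sum>a)\<^sup>2 / F\<^sup>2\<close> of the second
  derivative of \<open>ln F\<close>; what remains is the mean of the \<open>- \<beta> i\<close> with
  weights \<open>H i / F\<close>.\<close>

lemma has_d2_ln_sum:
  assumes "finite I" "\<And>i. i \<in> I \<Longrightarrow> has_d2 (H i) t (a i) (b i)"
    and "\<And>i. i \<in> I \<Longrightarrow> 0 \<le> H i t" "\<And>i. i \<in> I \<Longrightarrow> H i t = 0 \<Longrightarrow> a i = 0"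
    and b: "\<And>i. i \<in> I \<Longrightarrow> (a i)\<^sup>2 / H i t - \<beta> i * H i t \<le> b i"
    and pos: "0 < (\<Sum>i\<in>I. H i t)"
  obtains A B where "has_d2 (\<lambda>s. ln (\<Sum>i\<in>I. H i s)) t A B"
    "- (\<Sum>i\<in>I. \<beta> i * H i t) / (\<Sum>i\<in>I. H i t) \<le> B"
proof -
  define F where "F = (\<Sum>i\<in>I. H i t)"
  have "\<forall>\<^sub>F y in nhds F. (ln has_real_derivative inverse y) (at y)"
    using pos eventually_nhds_in_open[of "{0<..}" F]
    by (auto simp: F_def elim!: eventually_mono intro!: derivative_eq_intros simp: field_simps)
  moreover have "(inverse has_real_derivative - (inverse F * inverse F)) (at F)"
    using pos by (auto simp: F_def intro!: derivative_eq_intros)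
  moreover have "has_d2 (\<lambda>s. \<Sum>i\<in>I. H i s) t (\<Sum>i\<in>I. a i) (\<Sum>i\<in>I. b i)"
    using assms(2) by (rule has_d2_sum)
  ultimately have "has_d2 (\<lambda>s. ln (\<Sum>i\<in>I. H i s)) t (inverse F * (\<Sum>i\<in>I. a i))
    (- (inverse F * inverse F) * (\<Sum>i\<in>I. a i)\<^sup>2 + inverse F * (\<Sum>i\<in>I. b i))"
    unfolding F_def by (rule has_d2_compose)
  moreover have "- (\<Sum>i\<in>I. \<beta> i * H i t) / F \<le>
     - (inverse F * inverse F) * (\<Sum>i\<in>I. a i)\<^sup>2 + inverse F * (\<Sum>i\<in>I. b i)"
  proof -
    \<comment> \<open>A term with \<open>H i t = 0\<close> also has \<open>a i = 0\<close>, so the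
      factorization holds there, the quotient being \<open>0\<close> by convention.\<close>
    have "(\<Sum>i\<in>I. a i)\<^sup>2 = (\<Sum>i\<in>I. sqrt (H i t) * (a i / sqrt (H i t)))\<^sup>2"
      using assms(3,4) by (intro arg_cong[where f = "\<lambda>x. x\<^sup>2"] sum.cong) auto
    also have "\<dots> \<le> (\<Sum>i\<in>I. (sqrt (H i t))\<^sup>2) * (\<Sum>i\<in>I. (a i / sqrt (H i t))\<^sup>2)"
      by (rule Cauchy_Schwarz_ineq_sum)
    also have "\<dots> = F * (\<Sum>i\<in>I. (a i)\<^sup>2 / H i t)"
      using assms(3) by (simp add: F_def power_divide)
    also have "\<dots> \<le> F * ((\<Sum>i\<in>I. b i) + (\<Sum>i\<in>I. \<beta> i * H i t))"
    proof (rule mult_left_mono)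
      have "(a i)\<^sup>2 / H i t \<le> b i + \<beta> i * H i t" if "i \<in> I" for i
        using b[OF that] by linarith
      then show "(\<Sum>i\<in>I. (a i)\<^sup>2 / H i t) \<le> (\<Sum>i\<in>I. b i) + (\<Sum>i\<in>I. \<beta> i * H i t)"
        unfolding sum.distrib[symmetric] by (rule sum_mono)
    qed (use pos in \<open>simp add: F_def\<close>)
    finally have "inverse F * inverse F * (\<Sum>i\<in>I. a i)\<^sup>2 \<le>
        inverse F * inverse F * (F * ((\<Sum>i\<in>I. b i) + (\<Sum>i\<in>I. \<beta> i * H i t)))"
      by (rule mult_left_mono) simp
    also have "\<dots> = inverse F * ((\<Sum>i\<in>I. b i) + (\<Sum>i\<in>I. \<beta> i * H i t))"
      using pos by (simp add: F_def field_simps)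
    finally show ?thesis by (simp add: divide_inverse algebra_simps)
  qed
  ultimately show thesis using that unfolding F_def by blast
qed

text \<open>Where \<open>T\<close> is positive the function is \<open>exp\<close> of
  \<open>k w - 1 / T\<close>, and \<open>\<beta>\<close> bounds minus the second derivative of this
  exponent. Elsewhere flatness makes the value and both derivatives vanish. The conclusions are
  shaped as hypotheses of \<open>has_d2_ln_sum\<close>.\<close>

lemma has_d2_exp_flat:
  assumes w: "has_d2 w t a b" and T: "has_d2 T t a' b'"
    and \<beta>: "0 < T t \<Longrightarrow> 2 * a'\<^sup>2 / (T t) ^ 3 - b' / (T t)\<^sup>2 - k * b \<le> \<beta>"
  obtains A B where "has_d2 (\<lambda>s. exp (k * w s) * flat 0 (T s)) t A B"
    "exp (k * w t) * flat 0 (T t) = 0 \<Longrightarrow> A = 0"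
    "A\<^sup>2 / (exp (k * w t) * flat 0 (T t)) - \<beta> * (exp (k * w t) * flat 0 (T t)) \<le> B"
proof (cases "0 < T t")
  case True
  have "(T has_real_derivative a') (at t)" using T by (rule has_d2_DERIV)
  then have "filterlim T (nhds (T t)) (nhds t)"
    using DERIV_isCont by (auto simp: isCont_def tendsto_at_iff_tendsto_nhds)
  then have pos: "\<forall>\<^sub>F s in nhds t. 0 < T s"
    using True eventually_nhds_in_open[of "{0<..}" "T t"] by (auto simp: filterlim_iff)
  \<comment> \<open>\<open>c\<close> is the second derivative of the exponent
    \<open>k w - 1 / T\<close>, and \<open>A\<close> below is its first derivative.\<close>
  define c where "c = k * b + (- 2 / (T t) ^ 3 * a'\<^sup>2 + 1 / (T t)\<^sup>2 * b')"
  have inv: "has_d2 (\<lambda>s. - 1 / T s) t (1 / (T t)\<^sup>2 * a') (- 2 / (T t) ^ 3 * a'\<^sup>2 + 1 / (T t)\<^sup>2 * b')"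
  proof (rule has_d2_compose[OF _ _ T])
    show "\<forall>\<^sub>F y in nhds (T t). ((\<lambda>y. - 1 / y) has_real_derivative 1 / y\<^sup>2) (at y)"
      using True eventually_nhds_in_open[of "{0<..}" "T t"]
      by (auto elim!: eventually_mono intro!: derivative_eq_intros simp: power2_eq_square)
    show "((\<lambda>y. 1 / y\<^sup>2) has_real_derivative - 2 / (T t) ^ 3) (at (T t))"
      using True by (auto intro!: derivative_eq_intros simp: field_simps eval_nat_numeral)
  qed
  define A where "A = k * a + 1 / (T t)\<^sup>2 * a'"
  have "has_d2 (\<lambda>s. k * w s + (- 1 / T s)) t A c"
    unfolding A_def c_def by (rule has_d2_add[OF has_d2_cmult[OF w] inv])
  then have "has_d2 (\<lambda>s. exp (k * w s + (- 1 / T s))) t (exp (k * w t + (- 1 / T t)) * A)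
    (exp (k * w t + (- 1 / T t)) * A\<^sup>2 + exp (k * w t + (- 1 / T t)) * c)"
    by (intro has_d2_compose) (auto intro!: always_eventually DERIV_exp)
  moreover have "\<forall>\<^sub>F s in nhds t. exp (k * w s + (- 1 / T s)) = exp (k * w s) * flat 0 (T s)"
    using pos by eventually_elim (simp only: exp_add flat_def if_True power_0 div_by_1)
  ultimately have H: "has_d2 (\<lambda>s. exp (k * w s) * flat 0 (T s)) t (exp (k * w t + (- 1 / T t)) * A)
    (exp (k * w t + (- 1 / T t)) * A\<^sup>2 + exp (k * w t + (- 1 / T t)) * c)"
    by (rule has_d2_cong[rotated])
  have eq: "exp (k * w t) * flat 0 (T t) = exp (k * w t + (- 1 / T t))"
    using True by (simp only: exp_add flat_def if_True power_0 div_by_1)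
  have "- c \<le> \<beta>" using \<beta>[OF True] by (simp add: c_def)
  then have "- \<beta> * exp (k * w t + (- 1 / T t)) \<le> c * exp (k * w t + (- 1 / T t))"
    by (intro mult_right_mono) auto
  moreover define e where "e = exp (k * w t + (- 1 / T t))"
  moreover have "e > 0" by (simp add: e_def)
  ultimately have "(e * A)\<^sup>2 / e - \<beta> * e \<le> e * A\<^sup>2 + e * c" "e \<noteq> 0"
    by (simp_all add: power2_eq_square algebra_simps)
  then show thesis
    by (intro that[OF H]) (simp_all only: eq e_def[symmetric] simp_thms)
next
  case False
  \<comment> \<open>This includes the boundary case \<open>T t = 0\<close>, where
    \<open>flat 2\<close> and its derivative still vanish.\<close>
  have "has_d2 (\<lambda>s. flat 0 (T s)) t (flat 2 (T t) * a') (0 * a'\<^sup>2 + flat 2 (T t) * b')"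
  proof (rule has_d2_compose[OF _ _ T])
    show "\<forall>\<^sub>F y in nhds (T t). (flat 0 has_real_derivative flat 2 y) (at y)"
      using has_derivative_flat[of 0] by (simp add: numeral_2_eq_2)
    show "(flat 2 has_real_derivative 0) (at (T t))"
      using has_derivative_flat[of 2 "T t"] False by (simp add: flat_def)
  qed
  then have flat: "has_d2 (\<lambda>s. flat 0 (T s)) t 0 0" "flat 0 (T t) = 0"
    using False by (simp_all add: flat_def)
  have "has_d2 (\<lambda>s. exp (k * w s)) t (exp (k * w t) * (k * a)) (exp (k * w t) * (k * a)\<^sup>2 + exp (k * w t) * (k * b))"
    by (intro has_d2_compose[OF _ _ has_d2_cmult[OF w]]) (auto intro!: always_eventually DERIV_exp)
  from has_d2_mult[OF this flat(1)] have "has_d2 (\<lambda>s. exp (k * w s) * flat 0 (T s)) t 0 0"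
    by (simp add: flat(2))
  then show thesis using that flat(2) by simp
qed

section \<open>Affine minorants and uniform positivity\<close>

text \<open>The point \<open>(p, f p - \<delta>)\<close> is outside the closure of the epigraph. A
  hyperplane separating the two is not vertical, hence is the graph of an affine function passing
  between them.\<close>

lemma convex_on_affine_minorant:
  fixes f :: "'e::euclidean_space \<Rightarrow> real"
  assumes "open S" "convex_on S f" "continuous_on S f" "p \<in> S" "0 < \<delta>"
  obtains a b where "\<And>x. x \<in> S \<Longrightarrow> a \<bullet> x + b \<le> f x" "f p - \<delta> < a \<bullet> p + b"
proof -
  define E where "E = epigraph S f"
  \<comment> \<open>An open box around \<open>(p, f p - \<delta>)\<close> below the graph. Splitting
    at height \<open>f p - \<delta> / 2\<close> leaves room for the continuity of
    \<open>f\<close>.\<close>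
  define N where "N = (S \<inter> f -` {f p - \<delta> / 2<..}) \<times> {..<f p - \<delta> / 2}"
  have "open N" unfolding N_def
    by (intro open_Times continuous_open_preimage assms) auto
  moreover have "N \<inter> E = {}"
    by (auto simp: N_def E_def epigraph_def)
  ultimately have "N \<inter> closure E = {}"
    using open_Int_closure_eq_empty by blast
  moreover have "(p, f p - \<delta>) \<in> N"
    using assms by (auto simp: N_def)
  ultimately have "(p, f p - \<delta>) \<notin> closure E" by blast
  moreover have "convex (closure E)"
    unfolding E_def using assms(2) by (intro convex_closure) (rule convex_epigraphI)
  ultimately obtain c d where cd: "c \<bullet> (p, f p - \<delta>) < d" "\<And>x. x \<in> closure E \<Longrightarrow> d < c \<bullet> x"
    using separating_hyperplane_closed_point[OF _ closed_closure] by blast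
  obtain a r where c: "c = (a, r)" by (cases c)
  have gt: "d < a \<bullet> x + r * f x" if "x \<in> S" for x
  proof -
    have "(x, f x) \<in> closure E"
      using that by (intro subsetD[OF closure_subset]) (simp add: E_def epigraph_def)
    from cd(2)[OF this] show ?thesis by (simp add: c)
  qed
  have lt: "a \<bullet> p + r * (f p - \<delta>) < d" using cd(1) by (simp add: c)
  \<comment> \<open>Comparing the two sides of the hyperplane on the vertical line over
    \<open>p\<close> forces the vertical coefficient \<open>r\<close> to be positive, so it can be
    divided out.\<close>
  have "0 < r * \<delta>" using gt[OF assms(4)] lt by (simp add: algebra_simps)
  then have r: "0 < r" using assms(5) by (simp add: zero_less_mult_iff)
  show thesis
  proof (rule that)
    show "(- (1 / r) *\<^sub>R a) \<bullet> x + d / r \<le> f x" if "x \<in> S" for x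
      using gt[OF that] r by (simp add: field_simps)
    show "f p - \<delta> < (- (1 / r) *\<^sub>R a) \<bullet> p + d / r"
      using lt r by (simp add: field_simps)
  qed
qed

text \<open>The form attains a positive minimum \<open>m\<close> on the product of \<open>K\<close>
  with the unit sphere; by homogeneity \<open>C = 1 / m\<close> works for all vectors.\<close>

lemma pos_def_uniform:
  fixes G :: "'e::topological_space \<Rightarrow> real^'n^'n"
  assumes "compact K" "continuous_on K G"
    and pos: "\<And>z v. z \<in> K \<Longrightarrow> v \<noteq> 0 \<Longrightarrow> 0 < v \<bullet> (G z *v v)"
  obtains C where "0 < C" "\<And>z v. z \<in> K \<Longrightarrow> (norm v)\<^sup>2 \<le> C * (v \<bullet> (G z *v v))"
proof (cases "K = {}")
  case False
  define q where "q = (\<lambda>(z, v). v \<bullet> (G z *v v))"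
  have "compact (K \<times> sphere (0::real^'n) 1)"
    using assms(1) by (intro compact_Times) auto
  moreover have "K \<times> sphere (0::real^'n) 1 \<noteq> {}" using False by simp
  moreover have "continuous_on (K \<times> sphere 0 1) q"
  proof -
    have "continuous_on (K \<times> sphere (0::real^'n) 1) (\<lambda>x. G (fst x))"
      by (rule continuous_on_compose2[OF assms(2)]) (auto intro!: continuous_intros)
    then show ?thesis
      unfolding q_def case_prod_beta inner_vec_def matrix_vector_mult_def
      by (auto intro!: continuous_intros)
  qed
  ultimately obtain x where x: "x \<in> K \<times> sphere 0 1" "\<And>y. y \<in> K \<times> sphere 0 1 \<Longrightarrow> q x \<le> q y"
    using continuous_attains_inf[of "K \<times> sphere (0::real^'n) 1" q] by blast
  define m where "m = q x"
  have m: "0 < m" using x(1) pos[of "fst x" "snd x"] by (force simp: m_def q_def)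
  show thesis
  proof (rule that[of "1 / m"])
    fix z v assume z: "z \<in> K"
    show "(norm v)\<^sup>2 \<le> 1 / m * (v \<bullet> (G z *v v))"
    proof (cases "v = 0")
      case False
      define e where "e = (1 / norm v) *\<^sub>R v"
      have "m \<le> q (z, e)" unfolding m_def
        by (rule x(2)) (use z False in \<open>simp add: e_def\<close>)
      also have "\<dots> = (1 / norm v)\<^sup>2 * (v \<bullet> (G z *v v))"
        by (simp add: q_def e_def matrix_vector_mult_scaleR power2_eq_square)
      finally show ?thesis using False m by (simp add: field_simps)
    qed simp
  qed (use m in simp)
qed (use that[of 1] in auto)

section \<open>Affine charts and Hessian potentials\<close>

lemma chart_inv_eq: "chart_inv c = the_inv_into (fst c) (snd c)"
  by (simp add: chart_inv_def case_prod_beta)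

lemma chartD:
  assumes "is_chart c"
  shows "open (fst c)" "open (snd c ` fst c)" "inj_on (snd c) (fst c)"
    "continuous_on (fst c) (snd c)" "continuous_on (snd c ` fst c) (chart_inv c)"
proof -
  obtain x' where o: "open (fst c)" "open (snd c ` fst c)"
    and h: "homeomorphism (fst c) (snd c ` fst c) (snd c) x'"
    using assms by (auto simp: is_chart_def case_prod_beta)
  show "open (fst c)" "open (snd c ` fst c)" by fact+
  show inj: "inj_on (snd c) (fst c)"
    using homeomorphism_apply1[OF h] by (metis inj_onI)
  show "continuous_on (fst c) (snd c)" using homeomorphism_cont1[OF h] .
  have "x' z = chart_inv c z" if "z \<in> snd c ` fst c" for z
    using that homeomorphism_apply1[OF h] the_inv_into_f_f[OF inj] by (auto simp: chart_inv_eq)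
  then show "continuous_on (snd c ` fst c) (chart_inv c)"
    using homeomorphism_cont2[OF h] by (metis continuous_on_cong)
qed

lemma chart_inv_apply [simp]:
  assumes "is_chart c" "p \<in> fst c"
  shows "chart_inv c (snd c p) = p"
  using the_inv_into_f_f[OF chartD(3)[OF assms(1)] assms(2)] by (simp add: chart_inv_eq)

lemma chart_inv_mem:
  assumes "is_chart c" "z \<in> snd c ` fst c"
  shows "chart_inv c z \<in> fst c" "snd c (chart_inv c z) = z"
  using assms by auto

lemma open_chart_image:
  assumes "is_chart c" "open W"
  shows "open (snd c ` (fst c \<inter> W))"
proof -
  have "open (snd c ` fst c \<inter> chart_inv c -` W)"
    using chartD[OF assms(1)] assms(2) by (intro continuous_open_preimage)
  also have "snd c ` fst c \<inter> chart_inv c -` W = snd c ` (fst c \<inter> W)"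
    using assms(1) by auto
  finally show ?thesis .
qed

section \<open>Restriction of charts and affine coordinate changes\<close>

definition restrict_chart :: "('a, 'n) chart \<Rightarrow> 'a set \<Rightarrow> ('a, 'n::finite) chart" where
  "restrict_chart c W = (fst c \<inter> W, snd c)"

lemma restrict_chart_simps [simp]:
  "fst (restrict_chart c W) = fst c \<inter> W" "snd (restrict_chart c W) = snd c"
  by (simp_all add: restrict_chart_def)

lemma is_chart_restrict:
  assumes "is_chart c" "open W"
  shows "is_chart (restrict_chart c W)"
proof -
  obtain x' where "homeomorphism (fst c) (snd c ` fst c) (snd c) x'"
    using assms by (auto simp: is_chart_def case_prod_beta)
  then have "homeomorphism (fst c \<inter> W) (snd c ` (fst c \<inter> W)) (snd c) x'"
    by (rule homeomorphism_of_subsets) auto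
  then show ?thesis
    using chartD(1)[OF assms(1)] open_chart_image[OF assms] assms(2)
    by (auto simp: is_chart_def restrict_chart_def)
qed

lemma chart_inv_restrict:
  assumes "is_chart c" "open W" "z \<in> snd c ` (fst c \<inter> W)"
  shows "chart_inv (restrict_chart c W) z = chart_inv c z"
  using assms chart_inv_apply[OF is_chart_restrict[OF assms(1,2)]] by auto

lemma affine_transition_at_iff:
  "affine_transition_at c d p L b \<longleftrightarrow>
    (\<exists>W. open W \<and> p \<in> W \<and> W \<subseteq> fst c \<inter> fst d \<and> (\<forall>q\<in>W. snd d q = L *v snd c q + b))"
  by (simp add: affine_transition_at_def case_prod_beta)

lemma affine_transition_at_restrict:
  assumes "affine_transition_at c d p L b" "open W" "p \<in> W"
  shows "affine_transition_at (restrict_chart c W) d p L b"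
    "affine_transition_at c (restrict_chart d W) p L b"
proof -
  obtain V where "open V" "p \<in> V" "V \<subseteq> fst c \<inter> fst d" "\<forall>q\<in>V. snd d q = L *v snd c q + b"
    using assms(1) by (auto simp: affine_transition_at_iff)
  then show "affine_transition_at (restrict_chart c W) d p L b"
    "affine_transition_at c (restrict_chart d W) p L b"
    using assms(2,3) by (auto simp: affine_transition_at_iff intro!: exI[of _ "V \<inter> W"])
qed

lemma affine_transition_at_trans:
  assumes "affine_transition_at c d p L b" "affine_transition_at d e p L' b'"
  shows "affine_transition_at c e p (L' ** L) (L' *v b + b')"
proof -
  obtain V where V: "open V" "p \<in> V" "V \<subseteq> fst c \<inter> fst d" "\<forall>q\<in>V. snd d q = L *v snd c q + b"
    using assms(1) by (auto simp: affine_transition_at_iff)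
  obtain W where W: "open W" "p \<in> W" "W \<subseteq> fst d \<inter> fst e" "\<forall>q\<in>W. snd e q = L' *v snd d q + b'"
    using assms(2) by (auto simp: affine_transition_at_iff)
  have "snd e q = (L' ** L) *v snd c q + (L' *v b + b')" if "q \<in> V \<inter> W" for q
    using V(4) W(4) that
    by (simp add: matrix_vector_right_distrib matrix_vector_mul_assoc add.assoc)
  then show ?thesis
    using V W by (auto simp: affine_transition_at_iff intro!: exI[of _ "V \<inter> W"])
qed

lemma affine_charts_is_chart: "c \<in> affine_charts \<A> \<Longrightarrow> is_chart c"
  by (simp add: affine_charts_def)

lemma affine_charts_restrict:
  assumes "c \<in> affine_charts \<A>" "open W"
  shows "restrict_chart c W \<in> affine_charts \<A>"
proof -
  have "affinely_compatible (restrict_chart c W) d \<and> affinely_compatible d (restrict_chart c W)"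
    if "d \<in> \<A>" for d
  proof -
    have c: "affinely_compatible c d" "affinely_compatible d c"
      using assms(1) that by (auto simp: affine_charts_def)
    show ?thesis
    proof (intro conjI)
      show "affinely_compatible (restrict_chart c W) d"
        unfolding affinely_compatible_def
      proof
        fix p assume "p \<in> fst (restrict_chart c W) \<inter> fst d"
        then have p: "p \<in> fst c \<inter> fst d" "p \<in> W" by auto
        then obtain L b where "affine_transition_at c d p L b"
          using c(1) unfolding affinely_compatible_def by blast
        from affine_transition_at_restrict(1)[OF this assms(2) p(2)]
        show "\<exists>L b. affine_transition_at (restrict_chart c W) d p L b" by blast
      qed
      show "affinely_compatible d (restrict_chart c W)"
        unfolding affinely_compatible_def
      proof
        fix p assume "p \<in> fst d \<inter> fst (restrict_chart c W)"
        then have p: "p \<in> fst d \<inter> fst c" "p \<in> W" by auto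
        then obtain L b where "affine_transition_at d c p L b"
          using c(2) unfolding affinely_compatible_def by blast
        from affine_transition_at_restrict(2)[OF this assms(2) p(2)]
        show "\<exists>L b. affine_transition_at d (restrict_chart c W) p L b" by blast
      qed
    qed
  qed
  then show ?thesis
    using is_chart_restrict[OF affine_charts_is_chart[OF assms(1)] assms(2)]
    unfolding affine_charts_def by blast
qed

text \<open>A chart of the atlas around \<open>p\<close> mediates: compatibility gives one affine
  map into it and one out of it, and the two compose.\<close>

lemma affine_charts_transition:
  assumes "affine_atlas \<A>" "c \<in> affine_charts \<A>" "d \<in> affine_charts \<A>" "p \<in> fst c" "p \<in> fst d"
  obtains L b where "affine_transition_at c d p L b"
proof -
  have "p \<in> (\<Union>c\<in>\<A>. fst c)"
    using assms(1) unfolding affine_atlas_def by simp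
  then obtain e where e: "e \<in> \<A>" "p \<in> fst e" by blast
  have "affinely_compatible c e" "affinely_compatible e d"
    using assms(2,3) e(1) unfolding affine_charts_def by blast+
  then obtain L b L' b' where "affine_transition_at c e p L b" "affine_transition_at e d p L' b'"
    using assms(4,5) e(2) unfolding affinely_compatible_def by blast
  from affine_transition_at_trans[OF this] show thesis by (rule that)
qed

text \<open>Moves the affine formula from the manifold to an open set in the coordinate space of
  \<open>d\<close>, where derivatives along lines are taken.\<close>

lemma affine_transition_at_coords:
  assumes "is_chart d" "z \<in> snd d ` fst d" "affine_transition_at d c (chart_inv d z) L b"
  obtains N where "open N" "z \<in> N" "N \<subseteq> snd d ` fst d"
    "\<And>y. y \<in> N \<Longrightarrow> chart_inv d y \<in> fst c \<and> snd c (chart_inv d y) = L *v y + b"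
proof -
  obtain W where W: "open W" "chart_inv d z \<in> W" "W \<subseteq> fst d \<inter> fst c"
    "\<forall>q\<in>W. snd c q = L *v snd d q + b"
    using assms(3) by (auto simp: affine_transition_at_iff)
  show thesis
  proof (rule that[of "snd d ` (fst d \<inter> W)"])
    show "open (snd d ` (fst d \<inter> W))" by (rule open_chart_image[OF assms(1) W(1)])
    show "z \<in> snd d ` (fst d \<inter> W)"
      using chart_inv_mem[OF assms(1,2)] W(2) by (metis IntI image_eqI)
    show "chart_inv d y \<in> fst c \<and> snd c (chart_inv d y) = L *v y + b" if "y \<in> snd d ` (fst d \<inter> W)" for y
      using that W(3,4) assms(1) by auto
  qed auto
qed

section \<open>The metric and its potentials under changes of chart\<close>

text \<open>The transformation rule of a covariant tensor, with \<open>L\<close> moved across the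
  inner product. Bounds known in the chart of one piece can thus be read in any other affine
  chart.\<close>

lemma metric_transition:
  assumes "riemannian_metric \<A> g" "c \<in> affine_charts \<A>" "d \<in> affine_charts \<A>"
    and "p \<in> fst c" "p \<in> fst d" "affine_transition_at d c p L b"
  shows "v \<bullet> (g d p *v v) = (L *v v) \<bullet> (g c p *v (L *v v))"
proof -
  have "g d p = transpose L ** g c p ** L"
    using assms unfolding riemannian_metric_def by blast
  then have "g d p *v v = transpose L *v (g c p *v (L *v v))"
    by (simp add: matrix_vector_mul_assoc matrix_mul_assoc)
  then show ?thesis
    by (metis transpose_matrix_vector dot_lmul_matrix inner_commute)
qed

text \<open>A metric takes the whole chart as its argument, so the two matrices might formally
  differ. The coordinate change is the identity, and the transformation rule with
  \<open>L = mat 1\<close> identifies them.\<close>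

lemma metric_restrict_chart:
  assumes "riemannian_metric \<A> g" "c \<in> affine_charts \<A>" "open W" "p \<in> fst c" "p \<in> W"
  shows "g (restrict_chart c W) p = g c p"
proof -
  have "affine_transition_at c (restrict_chart c W) p (mat 1) 0"
    unfolding affine_transition_at_iff
    using chartD(1)[OF affine_charts_is_chart[OF assms(2)]] assms(3-5)
    by (intro exI[of _ "fst c \<inter> W"]) auto
  then have "g c p = transpose (mat 1) ** g (restrict_chart c W) p ** mat 1"
    using assms affine_charts_restrict[OF assms(2,3)] unfolding riemannian_metric_def
    by (metis IntI restrict_chart_simps(1))
  then show ?thesis by simp
qed

lemma frechet_derivative_cong_open:
  assumes "open S" "z \<in> S" "\<And>y. y \<in> S \<Longrightarrow> f y = h y"
  shows "frechet_derivative f (at z) = frechet_derivative h (at z)"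
proof -
  have "(f has_derivative D) (at z) \<longleftrightarrow> (h has_derivative D) (at z)" for D
    using has_derivative_transform_within_open[OF _ assms(1,2)] assms(3) by metis
  then show ?thesis by (simp add: frechet_derivative_def)
qed

lemma partial_deriv_cong_open:
  assumes "open S" "z \<in> S" "\<And>y. y \<in> S \<Longrightarrow> f y = h y"
  shows "partial_deriv i f z = partial_deriv i h z"
  using frechet_derivative_cong_open[OF assms] by (simp add: partial_deriv_def)

text \<open>Restriction changes the chart passed to \<open>g\<close> and to
  \<open>chart_inv\<close>. The former is settled by \<open>metric_restrict_chart\<close>, the
  latter because derivatives on the smaller open image see only values there.\<close>

lemma hessian_potential_restrict:
  assumes "riemannian_metric \<A> g" "c \<in> affine_charts \<A>" "open W" "hessian_potential g c \<phi>"
  shows "hessian_potential g (restrict_chart c W) \<phi>"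
proof -
  let ?d = "restrict_chart c W"
  let ?S = "snd c ` (fst c \<inter> W)"
  have c: "is_chart c" by (rule affine_charts_is_chart[OF assms(2)])
  have S: "open ?S" by (rule open_chart_image[OF c assms(3)])
  have eq: "(\<phi> \<circ> chart_inv c) z = (\<phi> \<circ> chart_inv ?d) z" if "z \<in> ?S" for z
    using chart_inv_restrict[OF c assms(3) that] by simp
  have "Ck_on k ?S (\<phi> \<circ> chart_inv ?d)" for k
  proof (rule Ck_on_cong[OF S eq])
    have "Ck_on k (snd c ` fst c) (\<phi> \<circ> chart_inv c)"
      using assms(4) by (simp add: hessian_potential_def smooth_in_chart_def smooth_on_def)
    then show "Ck_on k ?S (\<phi> \<circ> chart_inv c)" by (rule Ck_on_subset) auto
  qed
  moreover have "g ?d p $ i $ j = partial_deriv i (partial_deriv j (\<phi> \<circ> chart_inv ?d)) (snd c p)"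
    if p: "p \<in> fst c \<inter> W" for p i j
  proof -
    have "g ?d p $ i $ j = partial_deriv i (partial_deriv j (\<phi> \<circ> chart_inv c)) (snd c p)"
      using metric_restrict_chart[OF assms(1-3)] assms(4) p by (simp add: hessian_potential_def)
    also have "\<dots> = partial_deriv i (partial_deriv j (\<phi> \<circ> chart_inv ?d)) (snd c p)"
    proof (rule partial_deriv_cong_open[OF S])
      show "partial_deriv j (\<phi> \<circ> chart_inv c) y = partial_deriv j (\<phi> \<circ> chart_inv ?d) y" if "y \<in> ?S" for y
        using S that eq by (rule partial_deriv_cong_open)
    qed (use p in simp)
    finally show ?thesis .
  qed
  ultimately show ?thesis
    by (simp add: hessian_potential_def smooth_in_chart_def smooth_on_def)
qed

text \<open>Expanding the direction in the standard basis, once for each differentiation, turns the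
  iterated directional derivative into a double sum of second partial derivatives, which are the
  entries of \<open>g c p\<close>.\<close>

lemma second_deriv_potential:
  fixes c :: "('a::topological_space, 'n::finite) chart"
  assumes "is_chart c" "hessian_potential g c \<phi>" "p \<in> fst c"
  shows "second_deriv (\<phi> \<circ> chart_inv c) (snd c p) v = v \<bullet> (g c p *v v)"
proof -
  define f where "f = \<phi> \<circ> chart_inv c"
  let ?S = "snd c ` fst c"
  have S: "open ?S" by (rule chartD(2)[OF assms(1)])
  have ck: "Ck_on (Suc (Suc 0)) ?S f"
    using assms(2) by (simp add: hessian_potential_def smooth_in_chart_def smooth_on_def f_def del: Ck_on.simps)
  have expand: "D v = (\<Sum>j\<in>UNIV. v $ j * D (axis j 1))" if "linear D" for D :: "real^'n \<Rightarrow> real"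
  proof -
    have "D v = D (\<Sum>j\<in>UNIV. v $ j *\<^sub>R axis j 1)"
      using basis_expansion[of v] by (simp add: scalar_mult_eq_scaleR)
    then show ?thesis by (simp add: linear_sum[OF that] linear_scale[OF that])
  qed
  have lin: "linear (frechet_derivative h (at z))" if "h differentiable (at z)" for h :: "real^'n \<Rightarrow> real" and z
    using that by (rule linear_frechet_derivative)
  have z: "snd c p \<in> ?S" using assms(3) by simp
  have pd: "partial_deriv j f differentiable (at (snd c p))" for j
  proof -
    have "(\<lambda>y. frechet_derivative f (at y) v) differentiable (at (snd c p))" for v
      using ck z unfolding Ck_on.simps by blast
    moreover have "partial_deriv j f = (\<lambda>y. frechet_derivative f (at y) (axis j 1))"
      by (rule ext) (rule partial_deriv_def)
    ultimately show ?thesis by simp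
  qed
  have "second_deriv f (snd c p) v =
    frechet_derivative (\<lambda>y. \<Sum>j\<in>UNIV. v $ j * partial_deriv j f y) (at (snd c p)) v"
  proof -
    have "frechet_derivative f (at y) v = (\<Sum>j\<in>UNIV. v $ j * partial_deriv j f y)" if "y \<in> ?S" for y
      unfolding partial_deriv_def 
      by (rule expand, rule lin) (use ck that in \<open>unfold Ck_on.simps, blast\<close>)
    from frechet_derivative_cong_open[OF S z this] show ?thesis
      by (simp only: second_deriv_def)
  qed
  also have "\<dots> = (\<Sum>j\<in>UNIV. v $ j * frechet_derivative (partial_deriv j f) (at (snd c p)) v)"
  proof -
    have "((\<lambda>y. \<Sum>j\<in>UNIV. v $ j * partial_deriv j f y) has_derivative
      (\<lambda>v'. \<Sum>j\<in>UNIV. v $ j * frechet_derivative (partial_deriv j f) (at (snd c p)) v')) (at (snd c p))"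
      using pd by (intro has_derivative_sum has_derivative_mult_right)
        (simp add: frechet_derivative_works[symmetric])
    from fun_cong[OF frechet_derivative_at[OF this], of v] show ?thesis by (rule sym)
  qed
  also have "\<dots> = (\<Sum>j\<in>UNIV. v $ j * (\<Sum>i\<in>UNIV. v $ i * partial_deriv i (partial_deriv j f) (snd c p)))"
    by (intro sum.cong refl) (simp only: expand[OF lin[OF pd]] partial_deriv_def[of _ "partial_deriv _ f"])
  also have "\<dots> = (\<Sum>j\<in>UNIV. v $ j * (\<Sum>i\<in>UNIV. v $ i * g c p $ i $ j))"
    using assms(2,3) by (simp add: hessian_potential_def f_def)
  also have "\<dots> = (\<Sum>j\<in>UNIV. \<Sum>i\<in>UNIV. v $ i * (g c p $ i $ j * v $ j))"
    by (simp add: sum_distrib_left mult_ac)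
  also have "\<dots> = v \<bullet> (g c p *v v)"
    by (subst sum.swap) (simp add: inner_vec_def matrix_vector_mult_def sum_distrib_left)
  finally show ?thesis by (simp add: f_def)
qed

section \<open>Gluing local functions\<close>

lemma has_d2_unique: "has_d2 F t a b \<Longrightarrow> has_d2 F t a' b' \<Longrightarrow> b = b'"
  using DERIV_unique has_d2_DERIV_deriv by blast

lemma metric_nonneg:
  assumes "riemannian_metric \<A> g" "c \<in> affine_charts \<A>" "p \<in> fst c"
  shows "0 \<le> v \<bullet> (g c p *v v)"
proof (cases "v = 0")
  case False
  then have "0 < v \<bullet> (g c p *v v)"
    using assms unfolding riemannian_metric_def by blast
  then show ?thesis by simp
qed simp

text \<open>A continuous image of a compact ball is compact, hence closed in a Hausdorff space. The
  open complement is where a bump term is extended by \<open>0\<close>.\<close>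

lemma closed_chart_inv_cball:
  fixes c :: "('a::t2_space, 'n::finite) chart"
  assumes "is_chart c" "cball z r \<subseteq> snd c ` fst c"
  shows "closed (chart_inv c ` cball z r)"
  using chartD(5)[OF assms(1)] assms(2)
  by (intro compact_imp_closed compact_continuous_image) (auto intro: continuous_on_subset)

lemma continuous_on_UNIV_charts:
  fixes f :: "'a::t2_space \<Rightarrow> real"
  assumes "\<And>p. \<exists>c. is_chart (c :: ('a, 'n::finite) chart) \<and> p \<in> fst c \<and> smooth_in_chart c f"
  shows "continuous_on UNIV f"
  unfolding continuous_on_eq_continuous_at[OF open_UNIV]
proof
  fix p
  obtain c :: "('a, 'n) chart" where c: "is_chart c" "p \<in> fst c" "smooth_in_chart c f"
    using assms by blast
  have "Ck_on 0 (snd c ` fst c) (f \<circ> chart_inv c)"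
    using c(3) unfolding smooth_in_chart_def smooth_on_def by blast
  then have "continuous_on (fst c) (\<lambda>q. (f \<circ> chart_inv c) (snd c q))"
    using chartD(4)[OF c(1)] by (auto intro: continuous_on_compose2)
  then have "continuous_on (fst c) f"
    by (rule continuous_on_eq) (simp add: c(1))
  then show "isCont f p"
    using c(2) chartD(1)[OF c(1)] by (simp add: continuous_on_eq_continuous_at)
qed

section \<open>Bump terms and their smoothness\<close>

text \<open>The summand \<open>exp (k w - 1 / T)\<close> of the glued function, with
  \<open>T\<close> the difference of \<open>r\<^sup>2\<close> and the squared distance to
  \<open>z\<close>. Through \<open>flat 0\<close> it vanishes to infinite order where
  \<open>T\<close> reaches \<open>0\<close>.\<close>

definition bump_term ::
  "('a, 'n::finite) chart \<Rightarrow> (real^'n \<Rightarrow> real) \<Rightarrow> real^'n \<Rightarrow> real \<Rightarrow> real \<Rightarrow> 'a \<Rightarrow> real" where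
  "bump_term c w z r k p =
    (if p \<in> fst c then exp (k * w (snd c p)) * flat 0 (r\<^sup>2 - (norm (snd c p - z))\<^sup>2) else 0)"

lemma bump_term_nonneg: "0 \<le> bump_term c w z r k p"
  by (simp add: bump_term_def flat_nonneg)

lemma bump_term_eq_0:
  assumes "is_chart c" "0 < r" "p \<notin> chart_inv c ` cball z r"
  shows "bump_term c w z r k p = 0"
proof (cases "p \<in> fst c")
  case True
  then have "snd c p \<notin> cball z r"
    using assms(1,3) by (metis chart_inv_apply image_eqI)
  then have "r \<le> norm (snd c p - z)" by (simp add: dist_norm norm_minus_commute)
  then have "r\<^sup>2 \<le> (norm (snd c p - z))\<^sup>2" using assms(2) by (intro power_mono) auto
  then show ?thesis by (simp add: bump_term_def flat_def)
qed (simp add: bump_term_def)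

text \<open>The ball corresponds to a closed set inside the domain of \<open>c\<close>, so a point
  outside the domain has a neighbourhood missing this set. Hence the extension by \<open>0\<close>
  causes no jump at the edge of the chart.\<close>

lemma bump_term_eq_0_nbhd:
  fixes c d :: "('a::t2_space, 'n::finite) chart"
  assumes "is_chart c" "is_chart d" "0 < r" "cball z r \<subseteq> snd c ` fst c"
    and "y \<in> snd d ` fst d" "chart_inv d y \<notin> fst c"
  obtains N where "open N" "y \<in> N" "\<And>y'. y' \<in> N \<Longrightarrow> bump_term c w z r k (chart_inv d y') = 0"
proof (rule that[of "snd d ` (fst d \<inter> - chart_inv c ` cball z r)"])
  have "chart_inv c ` cball z r \<subseteq> fst c"
    using chart_inv_mem(1)[OF assms(1)] assms(4) by blast
  then have "chart_inv d y \<in> fst d \<inter> - chart_inv c ` cball z r"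
    using assms(6) chart_inv_mem(1)[OF assms(2,5)] by blast
  then show "y \<in> snd d ` (fst d \<inter> - chart_inv c ` cball z r)"
    using chart_inv_mem(2)[OF assms(2,5)] by (metis image_eqI)
  show "open (snd d ` (fst d \<inter> - chart_inv c ` cball z r))"
    using closed_chart_inv_cball[OF assms(1,4)] by (intro open_chart_image[OF assms(2)]) auto
  show "bump_term c w z r k (chart_inv d y') = 0"
    if "y' \<in> snd d ` (fst d \<inter> - chart_inv c ` cball z r)" for y'
    using that assms(2) by (intro bump_term_eq_0[OF assms(1,3)]) auto
qed

text \<open>Near a point of the domain of \<open>c\<close> the term is a smooth function of the
  coordinates of \<open>c\<close> composed with an affine map; near any other point it is
  \<open>0\<close>.\<close>

lemma smooth_bump_term:
  fixes c d :: "('a::{t2_space, second_countable_topology}, 'n::finite) chart"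
  assumes \<A>: "affine_atlas \<A>" "c \<in> affine_charts \<A>" "d \<in> affine_charts \<A>"
    and "0 < r" "cball z r \<subseteq> snd c ` fst c" "smooth_on (snd c ` fst c) w"
  shows "smooth_in_chart d (bump_term c w z r k)"
  unfolding smooth_in_chart_def smooth_on_def
proof (intro allI Ck_on_local)
  fix m y assume y: "y \<in> snd d ` fst d"
  have c: "is_chart c" and d: "is_chart d" by (rule affine_charts_is_chart, fact)+
  show "\<exists>N. open N \<and> y \<in> N \<and> Ck_on m N (bump_term c w z r k \<circ> chart_inv d)"
  proof (cases "chart_inv d y \<in> fst c")
    case True
    then obtain L b where "affine_transition_at d c (chart_inv d y) L b"
      using affine_charts_transition[OF \<A>(1,3,2)] chart_inv_mem(1)[OF d y] by blast
    then obtain N where N: "open N" "y \<in> N"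
      "\<And>y'. y' \<in> N \<Longrightarrow> chart_inv d y' \<in> fst c \<and> snd c (chart_inv d y') = L *v y' + b"
      using affine_transition_at_coords[OF d y] by metis
    \<comment> \<open>The difference is written as a sum with a multiple by \<open>- 1\<close> to
      match the rules for sums and products.\<close>
    let ?h = "\<lambda>x. exp (k * w x) * flat 0 (r\<^sup>2 + - 1 * (norm (x - z))\<^sup>2)"
    let ?S = "snd c ` fst c"
    have S: "open ?S" by (rule chartD(2)[OF c])
    have "Ck_on m ?S (\<lambda>x. k * w x)"
      using assms(6) by (intro Ck_on_mult Ck_on_const S) (simp add: smooth_on_def)
    then have "Ck_on m ?S (\<lambda>x. exp (k * w x))"
      by (rule Ck_on_compose_real[OF S open_UNIV _ Ck_on_exp, rotated]) simp
    moreover have "Ck_on m ?S (\<lambda>x. r\<^sup>2 + - 1 * (norm (x - z))\<^sup>2)"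
      by (intro Ck_on_add Ck_on_mult Ck_on_const S Ck_on_subset[OF Ck_on_norm_diff_sq]) auto
    then have "Ck_on m ?S (\<lambda>x. flat 0 (r\<^sup>2 + - 1 * (norm (x - z))\<^sup>2))"
      by (rule Ck_on_compose_real[OF S open_UNIV _ Ck_on_flat, rotated]) simp
    ultimately have h: "Ck_on m ?S ?h" by (rule Ck_on_mult[OF S])
    have "Ck_on m N (\<lambda>y'. ?h (L *v y' + b))"
    proof (rule Ck_on_compose_affine[OF N(1) _ h])
      show "L *v x + b \<in> ?S" if "x \<in> N" for x using N(3)[OF that] by (metis image_eqI)
    qed (rule matrix_vector_mul_bounded_linear)
    then have "Ck_on m N (bump_term c w z r k \<circ> chart_inv d)"
      by (rule Ck_on_cong[OF N(1), rotated]) (simp add: bump_term_def N(3))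
    then show ?thesis using N by blast
  next
    case False
    obtain N where N: "open N" "y \<in> N"
      "\<And>y'. y' \<in> N \<Longrightarrow> bump_term c w z r k (chart_inv d y') = 0"
      using bump_term_eq_0_nbhd[OF c d assms(4,5) y False] by metis
    have "Ck_on m N (bump_term c w z r k \<circ> chart_inv d)"
      by (rule Ck_on_cong[OF N(1) _ Ck_on_const[OF N(1), of m 0]]) (simp add: N(3))
    then show ?thesis using N by blast
  qed
qed

section \<open>Pieces and Hessian bounds for their bump terms\<close>

definition gluing_piece ::
  "('a::topological_space, 'n::finite) chart set \<Rightarrow> ('a, 'n) metric \<Rightarrow> real \<Rightarrow> ('a \<Rightarrow> real) \<Rightarrow> real \<Rightarrow>
    real \<Rightarrow> ('a, 'n) chart \<Rightarrow> (real^'n \<Rightarrow> real) \<Rightarrow> real^'n \<Rightarrow> real \<Rightarrow> bool" where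
  "gluing_piece \<A> g \<epsilon> v \<tau> K c w z r \<longleftrightarrow>
     c \<in> affine_charts \<A> \<and> 0 < r \<and> 0 \<le> K \<and> cball z r \<subseteq> snd c ` fst c \<and>
     smooth_on (snd c ` fst c) w \<and>
     (\<forall>p\<in>fst c. \<forall>\<eta>. - (1 - \<epsilon>) * (\<eta> \<bullet> (g c p *v \<eta>)) \<le> second_deriv w (snd c p) \<eta>) \<and>
     (\<forall>p\<in>fst c. \<forall>\<eta>. (norm \<eta>)\<^sup>2 \<le> K * (\<eta> \<bullet> (g c p *v \<eta>))) \<and>
     (\<forall>p\<in>fst c. w (snd c p) \<le> v p) \<and>
     (\<forall>p\<in>fst c. r / 2 \<le> norm (snd c p - z) \<longrightarrow> w (snd c p) \<le> v p - \<tau>)"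

text \<open>Bounds the Hessian of \<open>1 / T\<close> with \<open>T = r\<^sup>2 - |x - z|\<^sup>2\<close>.\<close>

definition barrier :: "real \<Rightarrow> real \<Rightarrow> real" where
  "barrier r T = 2 / T\<^sup>2 + 8 * r\<^sup>2 / T ^ 3"

text \<open>In the coordinates of \<open>c\<close> the line through \<open>y\<close> becomes a line
  with direction \<open>L *v \<eta>\<close>, so \<open>has_d2_exp_flat\<close> applies. In
  \<open>\<beta>\<close>, minus the Hessian of \<open>k w\<close> contributes at most
  \<open>k (1 - \<epsilon>) G\<close> and minus that of \<open>- 1 / T\<close> at most
  \<open>K G\<close> times the barrier. Multiplication by the bump term then replaces the barrier by
  \<open>M\<close>.\<close>

lemma has_d2_bump_term:
  fixes c d :: "('a::{t2_space, second_countable_topology}, 'n::finite) chart"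
  assumes \<A>: "affine_atlas \<A>" "riemannian_metric \<A> g" "d \<in> affine_charts \<A>"
    and piece: "gluing_piece \<A> g \<epsilon> v \<tau> K c w z r"
    and k: "0 \<le> k" and y: "y \<in> snd d ` fst d" and p: "p = chart_inv d y"
    and G: "G = \<eta> \<bullet> (g d p *v \<eta>)" and M: "0 \<le> M"
    and M_bound: "\<And>T. p \<in> fst c \<Longrightarrow> T = r\<^sup>2 - (norm (snd c p - z))\<^sup>2 \<Longrightarrow> 0 < T \<Longrightarrow>
      bump_term c w z r k p * barrier r T \<le> M"
  obtains A B \<beta> where "has_d2 (\<lambda>s. bump_term c w z r k (chart_inv d (y + s *\<^sub>R \<eta>))) 0 A B"
    "bump_term c w z r k p = 0 \<Longrightarrow> A = 0"
    "A\<^sup>2 / bump_term c w z r k p - \<beta> * bump_term c w z r k p \<le> B"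
    "\<beta> * bump_term c w z r k p \<le> G * (k * (1 - \<epsilon>) * bump_term c w z r k p + K * M)"
proof -
  have c: "c \<in> affine_charts \<A>" "0 < r" "0 \<le> K" "cball z r \<subseteq> snd c ` fst c"
    "smooth_on (snd c ` fst c) w"
    using piece by (auto simp: gluing_piece_def)
  have ch: "is_chart c" "is_chart d" by (rule affine_charts_is_chart, fact)+
  have pd: "p \<in> fst d" using chart_inv_mem(1)[OF ch(2) y] by (simp add: p)
  have G0: "0 \<le> G" unfolding G by (rule metric_nonneg[OF \<A>(2,3) pd])
  have GKM: "0 \<le> G * (K * M)" using G0 c(3) M by simp
  show thesis
  proof (cases "p \<in> fst c")
    case False
    then obtain N where N: "open N" "y \<in> N"
      "\<And>y'. y' \<in> N \<Longrightarrow> bump_term c w z r k (chart_inv d y') = 0"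
      using bump_term_eq_0_nbhd[OF ch c(2,4) y] unfolding p by metis
    have "\<forall>\<^sub>F s in nhds 0. 0 = bump_term c w z r k (chart_inv d (y + s *\<^sub>R \<eta>))"
      using eventually_line_mem[OF N(1,2), of \<eta>] by eventually_elim (simp add: N(3))
    from has_d2_cong[OF this has_d2_const]
    have "has_d2 (\<lambda>s. bump_term c w z r k (chart_inv d (y + s *\<^sub>R \<eta>))) 0 0 0" .
    moreover have "bump_term c w z r k p = 0" using False by (simp add: bump_term_def)
    ultimately show thesis using GKM by (intro that[of 0 0 0]) auto
  next
    case True
    obtain L b where Lb: "affine_transition_at d c p L b"
      using affine_charts_transition[OF \<A>(1,3) c(1) pd True] .
    obtain N where N: "open N" "y \<in> N"
      "\<And>y'. y' \<in> N \<Longrightarrow> chart_inv d y' \<in> fst c \<and> snd c (chart_inv d y') = L *v y' + b"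
      using affine_transition_at_coords[OF ch(2) y] Lb unfolding p by metis
    define x where "x = snd c p"
    define \<xi> where "\<xi> = L *v \<eta>"
    have G': "G = \<xi> \<bullet> (g c p *v \<xi>)"
      unfolding G \<xi>_def by (rule metric_transition[OF \<A>(2) c(1) \<A>(3) True pd Lb])
    have x: "x = L *v y + b" using N(2,3) by (simp add: x_def p)
    have line: "L *v (y + s *\<^sub>R \<eta>) + b = x + s *\<^sub>R \<xi>" for s
      by (simp add: x \<xi>_def matrix_vector_right_distrib matrix_vector_mult_scaleR)
    define W where "W s = w (x + s *\<^sub>R \<xi>)" for s
    define T where "T s = r\<^sup>2 + - 1 * (norm (x + s *\<^sub>R \<xi> - z))\<^sup>2" for s
    have T0: "T 0 = r\<^sup>2 - (norm (snd c p - z))\<^sup>2" by (simp add: T_def x_def)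
    have H0: "exp (k * W 0) * flat 0 (T 0) = bump_term c w z r k p"
      using True by (simp add: bump_term_def T0 W_def x_def)
    \<comment> \<open>Agreement while the line stays in \<open>N\<close> is enough, since
      \<open>has_d2\<close> depends on the germ at \<open>0\<close>.\<close>
    have "\<forall>\<^sub>F s in nhds 0. exp (k * W s) * flat 0 (T s) = bump_term c w z r k (chart_inv d (y + s *\<^sub>R \<eta>))"
      using eventually_line_mem[OF N(1,2), of \<eta>]
      by eventually_elim (simp add: N(3) bump_term_def W_def T_def line)
    note germ = has_d2_cong[OF this]
    have dW: "has_d2 W 0 (frechet_derivative w (at x) \<xi>) (second_deriv w x \<xi>)"
      unfolding W_def
    proof (rule has_d2_line)
      show "Ck_on (Suc (Suc 0)) (snd c ` fst c) w" using c(5) unfolding smooth_on_def by blast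
    qed (use chartD(2)[OF ch(1)] True in \<open>auto simp: x_def\<close>)
    have dT: "has_d2 T 0 (0 + - 1 * (2 * ((x - z) \<bullet> \<xi>))) (0 + - 1 * (2 * (norm \<xi>)\<^sup>2))"
      unfolding T_def by (intro has_d2_add has_d2_const has_d2_cmult has_d2_norm_sq_line)
    \<comment> \<open>For \<open>T 0 \<le> 0\<close> the bump term is \<open>0\<close>, and the
      default \<open>0\<close> satisfies the required estimates.\<close>
    define \<beta> where "\<beta> = (if 0 < T 0 then G * (k * (1 - \<epsilon>) + K * barrier r (T 0)) else 0)"
    have "2 * (0 + - 1 * (2 * ((x - z) \<bullet> \<xi>)))\<^sup>2 / (T 0) ^ 3
        - (0 + - 1 * (2 * (norm \<xi>)\<^sup>2)) / (T 0)\<^sup>2 - k * second_deriv w x \<xi> \<le> \<beta>"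
      if pos: "0 < T 0"
    proof -
      \<comment> \<open>The gradient of \<open>T\<close> is \<open>- 2 (x - z)\<close>, and its
        square times \<open>2 / T ^ 3\<close> gives the coefficient \<open>8\<close>. Cauchy-Schwarz
        with \<open>norm (x - z) < r\<close> then yields the cubic part of the barrier.\<close>
      have "\<bar>(x - z) \<bullet> \<xi>\<bar> \<le> norm (x - z) * norm \<xi>" by (rule Cauchy_Schwarz_ineq2)
      then have "\<bar>(x - z) \<bullet> \<xi>\<bar>\<^sup>2 \<le> (norm (x - z) * norm \<xi>)\<^sup>2" by (rule power_mono) simp
      then have "((x - z) \<bullet> \<xi>)\<^sup>2 \<le> (norm (x - z))\<^sup>2 * (norm \<xi>)\<^sup>2"
        by (simp add: power_mult_distrib)
      also have "\<dots> \<le> r\<^sup>2 * (norm \<xi>)\<^sup>2"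
        using pos by (intro mult_right_mono) (auto simp: T0 x_def)
      finally have "8 * ((x - z) \<bullet> \<xi>)\<^sup>2 / (T 0) ^ 3 \<le> 8 * (r\<^sup>2 * (norm \<xi>)\<^sup>2) / (T 0) ^ 3"
        using pos by (intro divide_right_mono) auto
      then have "8 * ((x - z) \<bullet> \<xi>)\<^sup>2 / (T 0) ^ 3 + 2 * (norm \<xi>)\<^sup>2 / (T 0)\<^sup>2 \<le> (norm \<xi>)\<^sup>2 * barrier r (T 0)"
        by (simp add: barrier_def algebra_simps)
      also have "\<dots> \<le> (K * G) * barrier r (T 0)"
      proof (rule mult_right_mono)
        show "(norm \<xi>)\<^sup>2 \<le> K * G"
          using piece True unfolding G' gluing_piece_def by blast
      qed (use pos in \<open>simp add: barrier_def\<close>)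
      finally have 1: "8 * ((x - z) \<bullet> \<xi>)\<^sup>2 / (T 0) ^ 3 + 2 * (norm \<xi>)\<^sup>2 / (T 0)\<^sup>2 \<le> (K * G) * barrier r (T 0)" .
      have "- (1 - \<epsilon>) * G \<le> second_deriv w x \<xi>"
        using piece True unfolding G' gluing_piece_def x_def by blast
      then have 2: "k * (- (1 - \<epsilon>) * G) \<le> k * second_deriv w x \<xi>"
        using k by (rule mult_left_mono)
      have "2 * (0 + - 1 * (2 * ((x - z) \<bullet> \<xi>)))\<^sup>2 / (T 0) ^ 3 = 8 * ((x - z) \<bullet> \<xi>)\<^sup>2 / (T 0) ^ 3"
        by (simp add: power2_eq_square)
      moreover have "\<beta> = k * ((1 - \<epsilon>) * G) + (K * G) * barrier r (T 0)"
        using pos by (simp add: \<beta>_def algebra_simps)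
      moreover have "(0 + - 1 * (2 * (norm \<xi>)\<^sup>2)) / (T 0)\<^sup>2 = - (2 * (norm \<xi>)\<^sup>2 / (T 0)\<^sup>2)"
        by simp
      moreover have "k * (- (1 - \<epsilon>) * G) = - (k * ((1 - \<epsilon>) * G))" by (simp only: mult_minus_left mult_minus_right)
      ultimately show ?thesis using 1 2 by linarith
    qed
    from has_d2_exp_flat[OF dW dT this]
    obtain A B where AB: "has_d2 (\<lambda>s. exp (k * W s) * flat 0 (T s)) 0 A B"
      "bump_term c w z r k p = 0 \<Longrightarrow> A = 0"
      "A\<^sup>2 / bump_term c w z r k p - \<beta> * bump_term c w z r k p \<le> B"
      unfolding H0 by blast
    have "\<beta> * bump_term c w z r k p \<le> G * (k * (1 - \<epsilon>) * bump_term c w z r k p + K * M)"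
    proof (cases "0 < T 0")
      case pos: True
      have "bump_term c w z r k p * barrier r (T 0) \<le> M"
        using M_bound[OF True T0 pos] .
      then have "(G * K) * (bump_term c w z r k p * barrier r (T 0)) \<le> (G * K) * M"
        using G0 c(3) by (intro mult_left_mono) auto
      then show ?thesis using pos by (simp add: \<beta>_def algebra_simps)
    next
      case False
      then have "bump_term c w z r k p = 0" using H0 by (simp add: flat_def)
      then show ?thesis using GKM by simp
    qed
    then show thesis using that[OF germ[OF AB(1)] AB(2,3)] by blast
  qed
qed

text \<open>In the ball of radius \<open>r / 2\<close> the barrier is bounded and the term is at
  most \<open>F\<close>. Outside it the gap \<open>\<tau>\<close> bounds the exponential by
  \<open>F / \<mu>\<close>, and the flat factor tames the barrier. The factor in front of
  \<open>F\<close> does not involve \<open>k\<close>, which is why division by \<open>k\<close> can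
  later make this contribution small.\<close>

lemma bump_term_barrier_bound:
  assumes piece: "gluing_piece \<A> g \<epsilon> v \<tau> K c w z r" and k: "0 \<le> k" and p: "p \<in> fst c"
    and T: "T = r\<^sup>2 - (norm (snd c p - z))\<^sup>2" "0 < T"
    and \<mu>: "0 < \<mu>" "\<mu> * exp (k * (v p - \<tau>)) \<le> F" and F: "bump_term c w z r k p \<le> F"
  shows "bump_term c w z r k p * barrier r T \<le> (barrier r (3 / 4 * r\<^sup>2) + (4 + 48 * r\<^sup>2) / \<mu>) * F"
proof -
  have r: "0 < r" using piece by (simp add: gluing_piece_def)
  have F0: "0 \<le> F" by (rule order_trans[OF bump_term_nonneg F])
  have b0: "0 \<le> barrier r s" if "0 < s" for s using that by (simp add: barrier_def)
  have b: "0 \<le> barrier r (3 / 4 * r\<^sup>2)" using r by (intro b0) simp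
  show ?thesis
  proof (cases "norm (snd c p - z) < r / 2")
    case True
    then have "(norm (snd c p - z))\<^sup>2 \<le> (r / 2)\<^sup>2" by (intro power_mono) auto
    then have le: "3 / 4 * r\<^sup>2 \<le> T" by (simp add: T power_divide)
    have "barrier r T \<le> barrier r (3 / 4 * r\<^sup>2)"
    proof -
      have s: "0 < 3 / 4 * r\<^sup>2" using r by simp
      have "2 / T\<^sup>2 \<le> 2 / (3 / 4 * r\<^sup>2)\<^sup>2"
        by (rule divide_left_mono[OF power_mono[OF le]]) (use s T(2) in simp_all)
      moreover have "8 * r\<^sup>2 / T ^ 3 \<le> 8 * r\<^sup>2 / (3 / 4 * r\<^sup>2) ^ 3"
        by (rule divide_left_mono[OF power_mono[OF le]]) (use s T(2) in simp_all)
      ultimately show ?thesis by (simp only: barrier_def)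
    qed
    then have "bump_term c w z r k p * barrier r T \<le> F * barrier r (3 / 4 * r\<^sup>2)"
      using F F0 b0[OF T(2)] by (intro mult_mono) auto
    moreover have "0 \<le> (4 + 48 * r\<^sup>2) / \<mu> * F" using \<mu>(1) F0 by simp
    ultimately show ?thesis by (simp add: algebra_simps)
  next
    case False
    then have "w (snd c p) \<le> v p - \<tau>" using piece p by (simp add: gluing_piece_def)
    then have "k * w (snd c p) \<le> k * (v p - \<tau>)" using k by (rule mult_left_mono)
    then have "\<mu> * exp (k * w (snd c p)) \<le> \<mu> * exp (k * (v p - \<tau>))"
      using \<mu>(1) by (intro mult_left_mono) auto
    also note \<mu>(2)
    finally have e: "exp (k * w (snd c p)) \<le> F / \<mu>"
      using \<mu>(1) by (simp add: pos_le_divide_eq mult.commute)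
    \<comment> \<open>The powers of \<open>T\<close> in the barrier turn \<open>flat 0\<close> into
      \<open>flat 2\<close> and \<open>flat 3\<close>, bounded by \<open>2\<close> and
      \<open>6\<close>; hence the constants \<open>4\<close> and \<open>48\<close>.\<close>
    have "bump_term c w z r k p * barrier r T = exp (k * w (snd c p)) * (2 * flat 2 T + 8 * r\<^sup>2 * flat 3 T)"
      using p T(2) by (simp add: bump_term_def T(1)[symmetric] barrier_def flat_def field_simps)
    also have "\<dots> \<le> F / \<mu> * (2 * 2 + 8 * r\<^sup>2 * 6)"
    proof (rule mult_mono[OF e])
      have "flat 2 T \<le> 2" "flat 3 T \<le> 6"
        using flat_le_fact[of 2 T] flat_le_fact[of 3 T] by (simp_all add: fact_numeral)
      then show "2 * flat 2 T + 8 * r\<^sup>2 * flat 3 T \<le> 2 * 2 + 8 * r\<^sup>2 * 6"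
        by (intro add_mono mult_left_mono) auto
      show "0 \<le> 2 * flat 2 T + 8 * r\<^sup>2 * flat 3 T"
        by (simp add: flat_nonneg)
    qed (use F0 \<mu>(1) in simp)
    also have "\<dots> = (4 + 48 * r\<^sup>2) / \<mu> * F" by simp
    also have "\<dots> \<le> (barrier r (3 / 4 * r\<^sup>2) + (4 + 48 * r\<^sup>2) / \<mu>) * F"
      using b F0 by (intro mult_right_mono) auto
    finally show ?thesis .
  qed
qed

section \<open>Construction of local pieces\<close>

text \<open>\<open>V\<close> and \<open>\<tau>\<^sub>0\<close> depend on \<open>q\<close> but not on
  \<open>p\<close>, so compactness can fix one gap \<open>\<tau>\<close> before any minorant is
  chosen. The minorant is then taken with error \<open>\<tau>\<close>.\<close>

lemma gluing_piece_local:
  fixes \<A> :: "('a::{t2_space, second_countable_topology}, 'n::finite) chart set"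
  assumes "hessian_manifold \<A> g" "u \<in> g_convex_functions \<A> g" and \<epsilon>: "0 < \<epsilon>" "\<epsilon> < 1"
  obtains V \<tau>\<^sub>0 K where "open V" "q \<in> V" "0 < \<tau>\<^sub>0"
    "\<And>p \<tau>. p \<in> V \<Longrightarrow> 0 < \<tau> \<Longrightarrow> \<tau> \<le> \<tau>\<^sub>0 \<Longrightarrow>
      \<exists>c w z r. gluing_piece \<A> g (\<epsilon> / 2) (\<lambda>p. (1 - \<epsilon>) * u p) \<tau> K c w z r \<and> p \<in> fst c \<and>
        norm (snd c p - z) < r / 2 \<and> (1 - \<epsilon>) * u p - \<tau> < w (snd c p)"
proof -
  have \<A>: "affine_atlas \<A>" and g: "riemannian_metric \<A> g"
    using assms(1) by (auto simp: hessian_manifold_def hessian_metric_def)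
  obtain c0 \<phi> where c0: "c0 \<in> affine_charts \<A>" "q \<in> fst c0" "hessian_potential g c0 \<phi>"
    using assms(1) unfolding hessian_manifold_def hessian_metric_def by blast
  have ch0: "is_chart c0" by (rule affine_charts_is_chart[OF c0(1)])
  define x where "x = snd c0 q"
  have "x \<in> snd c0 ` fst c0" using c0(2) by (simp add: x_def)
  then obtain R where R: "0 < R" "cball x R \<subseteq> snd c0 ` fst c0"
    using chartD(2)[OF ch0] by (meson open_contains_cball)
  define W where "W = fst c0 \<inter> snd c0 -` ball x R"
  have W: "open W" unfolding W_def
    using chartD[OF ch0] by (intro continuous_open_preimage) auto
  \<comment> \<open>Cutting the chart down to a coordinate ball makes its image convex, so that
    \<open>g\<close>-convexity of \<open>u\<close> says something about it.\<close>
  define c where "c = restrict_chart c0 W"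
  have c: "c \<in> affine_charts \<A>" unfolding c_def by (rule affine_charts_restrict[OF c0(1) W])
  have ch: "is_chart c" by (rule affine_charts_is_chart[OF c])
  have fst_c: "fst c = W" and snd_c: "snd c = snd c0" by (auto simp: c_def W_def)
  have "ball x R \<subseteq> snd c0 ` fst c0" using R(2) ball_subset_cball by blast
  then have img: "snd c ` fst c = ball x R" by (auto simp: fst_c snd_c W_def)
  have pot: "hessian_potential g c \<phi>"
    unfolding c_def by (rule hessian_potential_restrict[OF g c0(1) W c0(3)])
  define f where "f = \<phi> \<circ> chart_inv c"
  have f_smooth: "smooth_on (ball x R) f"
    using pot img by (simp add: hessian_potential_def smooth_in_chart_def f_def)
  have cvx: "convex_on (ball x R) ((\<lambda>p. \<phi> p + u p) \<circ> chart_inv c)"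
  proof -
    have "convex (snd c ` fst c)" by (simp add: img)
    then have "convex_on (snd c ` fst c) ((\<lambda>p. \<phi> p + u p) \<circ> chart_inv c)"
      using assms(2) c pot unfolding g_convex_functions_def by blast
    then show ?thesis by (simp only: img)
  qed
  have cont: "continuous_on (ball x R) ((\<lambda>p. \<phi> p + u p) \<circ> chart_inv c)"
    using cvx by (rule convex_on_continuous[OF open_ball])
  \<comment> \<open>The closed ball lies inside the original chart, so compactness gives one
    \<open>K\<close> for all of the smaller chart.\<close>
  obtain K where K: "0 < K" "\<And>y \<eta>. y \<in> cball x R \<Longrightarrow> (norm \<eta>)\<^sup>2 \<le> K * (\<eta> \<bullet> (g c0 (chart_inv c0 y) *v \<eta>))"
  proof (rule pos_def_uniform[of "cball x R" "\<lambda>y. g c0 (chart_inv c0 y)"])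
    have "Ck_on 0 (snd c0 ` fst c0) (g c0 \<circ> chart_inv c0)"
      using g c0(1) unfolding riemannian_metric_def smooth_in_chart_def smooth_on_def by blast
    then show "continuous_on (cball x R) (\<lambda>y. g c0 (chart_inv c0 y))"
      using R(2) by (simp add: comp_def continuous_on_subset)
    show "0 < v \<bullet> (g c0 (chart_inv c0 y) *v v)" if "y \<in> cball x R" "v \<noteq> 0" for y v
      using g c0(1) that(2) chart_inv_mem(1)[OF ch0 subsetD[OF R(2) that(1)]]
      unfolding riemannian_metric_def by blast
  qed auto
  have K_c: "(norm \<eta>)\<^sup>2 \<le> K * (\<eta> \<bullet> (g c p *v \<eta>))" if "p \<in> fst c" for p \<eta>
  proof -
    have p: "p \<in> fst c0" "p \<in> W" "snd c0 p \<in> cball x R" using that by (auto simp: fst_c W_def)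
    have "g c p = g c0 p" unfolding c_def by (rule metric_restrict_chart[OF g c0(1) W p(1,2)])
    then show ?thesis using K(2)[OF p(3)] p(1) ch0 by simp
  qed
  \<comment> \<open>The penalty \<open>e * (norm (y - z))\<^sup>2\<close> has Hessian at most
    \<open>2 * e * K = \<epsilon> / 2\<close> times \<open>g\<close>, which weakens the bound from
    \<open>1 - \<epsilon>\<close> to \<open>1 - \<epsilon> / 2\<close>.\<close>
  define e where "e = \<epsilon> / (4 * K)"
  have e: "0 < e" using \<epsilon> K by (simp add: e_def)
  \<comment> \<open>Centres in \<open>V\<close> are within \<open>R / 2\<close> of \<open>x\<close>,
    and \<open>R / 2 + R / 3 < R\<close> keeps their balls inside the chart.\<close>
  define r where "r = R / 3"
  define V where "V = fst c0 \<inter> snd c0 -` ball x (R / 2)"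
  \<comment> \<open>The bound \<open>e * (r / 2)\<^sup>2\<close> on the gap is the smallest penalty
    paid outside the ball of radius \<open>r / 2\<close>.\<close>
  show thesis
  proof (rule that[of V "e * (r / 2)\<^sup>2" K])
    show "open V" unfolding V_def
      using chartD[OF ch0] by (intro continuous_open_preimage) auto
    show "q \<in> V" using c0(2) R(1) by (simp add: V_def x_def)
    show "0 < e * (r / 2)\<^sup>2" using e R(1) by (simp add: r_def)
  next
    fix p \<tau> assume p: "p \<in> V" and \<tau>: "0 < \<tau>" "\<tau> \<le> e * (r / 2)\<^sup>2"
    have pc: "p \<in> fst c" using p R(1) by (auto simp: V_def fst_c W_def)
    define z where "z = snd c p"
    have z: "z \<in> ball x R" using pc img by (auto simp: z_def)
    have zr: "cball z r \<subseteq> ball x R"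
    proof
      fix y assume "y \<in> cball z r"
      then have "dist x y \<le> dist x z + r" using dist_triangle[of x y z] by simp
      moreover have "dist x z < R / 2" using p by (simp add: V_def z_def snd_c)
      ultimately show "y \<in> ball x R" using R(1) by (simp add: r_def)
    qed
    obtain a b where ab: "\<And>y. y \<in> ball x R \<Longrightarrow> a \<bullet> y + b \<le> ((\<lambda>p. \<phi> p + u p) \<circ> chart_inv c) y"
      "((\<lambda>p. \<phi> p + u p) \<circ> chart_inv c) z - \<tau> < a \<bullet> z + b"
      using convex_on_affine_minorant[OF open_ball cvx cont z \<tau>(1)] by blast
    define w where "w y = (1 - \<epsilon>) * ((a \<bullet> y + b) + - 1 * f y) + - e * (norm (y - z))\<^sup>2" for y
    have w_le: "w (snd c p') \<le> (1 - \<epsilon>) * u p' - e * (norm (snd c p' - z))\<^sup>2" if "p' \<in> fst c" for p'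
    proof -
      have "snd c p' \<in> ball x R" using that img by blast
      from ab(1)[OF this] have "(a \<bullet> snd c p' + b) + - 1 * f (snd c p') \<le> u p'"
        using that ch by (simp add: f_def)
      then have "(1 - \<epsilon>) * ((a \<bullet> snd c p' + b) + - 1 * f (snd c p')) \<le> (1 - \<epsilon>) * u p'"
        using \<epsilon> by (intro mult_left_mono) auto
      then show ?thesis by (simp add: w_def)
    qed
    have w_smooth: "smooth_on (ball x R) w"
      unfolding smooth_on_def
    proof
      fix k
      have "Ck_on k (ball x R) f" using f_smooth by (simp add: smooth_on_def)
      then show "Ck_on k (ball x R) w" unfolding w_def
        by (intro Ck_on_add Ck_on_mult Ck_on_const open_ball
            Ck_on_bounded_linear[OF open_ball bounded_linear_inner_right]
            Ck_on_subset[OF Ck_on_norm_diff_sq]) auto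
    qed
    have "gluing_piece \<A> g (\<epsilon> / 2) (\<lambda>p. (1 - \<epsilon>) * u p) \<tau> K c w z r"
      unfolding gluing_piece_def
    proof (intro conjI ballI allI impI)
      show "cball z r \<subseteq> snd c ` fst c" "smooth_on (snd c ` fst c) w"
        using zr w_smooth by (simp_all only: img)
      fix p' assume p': "p' \<in> fst c"
      have y: "snd c p' \<in> ball x R" using p' img by blast
      show "(norm \<eta>)\<^sup>2 \<le> K * (\<eta> \<bullet> (g c p' *v \<eta>))" for \<eta> by (rule K_c[OF p'])
      have "0 \<le> e * (norm (snd c p' - z))\<^sup>2" using e by simp
      then show "w (snd c p') \<le> (1 - \<epsilon>) * u p'" using w_le[OF p'] by linarith
      show "w (snd c p') \<le> (1 - \<epsilon>) * u p' - \<tau>" if "r / 2 \<le> norm (snd c p' - z)"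
      proof -
        have "e * (r / 2)\<^sup>2 \<le> e * (norm (snd c p' - z))\<^sup>2"
          using that e R(1) by (intro mult_left_mono power_mono) (auto simp: r_def)
        then show ?thesis using w_le[OF p'] \<tau>(2) by linarith
      qed
      fix \<eta>
      define G where "G = \<eta> \<bullet> (g c p' *v \<eta>)"
      have "has_d2 (\<lambda>s. (a \<bullet> (snd c p' + s *\<^sub>R \<eta>) + b)) 0 (a \<bullet> \<eta>) 0"
        by (rule has_d2I[where F' = "\<lambda>_. a \<bullet> \<eta>"])
          (auto simp: inner_simps intro!: always_eventually derivative_eq_intros)
      moreover have "has_d2 (\<lambda>s. f (snd c p' + s *\<^sub>R \<eta>)) 0
          (frechet_derivative f (at (snd c p')) \<eta>) G"
        using has_d2_line[OF open_ball _ y, of 0 f \<eta>] f_smooth second_deriv_potential[OF ch pot p']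
        unfolding smooth_on_def f_def[symmetric] G_def by metis
      ultimately have "has_d2 (\<lambda>s. w (snd c p' + s *\<^sub>R \<eta>)) 0
          ((1 - \<epsilon>) * (a \<bullet> \<eta> + - 1 * frechet_derivative f (at (snd c p')) \<eta>) + - e * (2 * ((snd c p' - z) \<bullet> \<eta>)))
          ((1 - \<epsilon>) * (0 + - 1 * G) + - e * (2 * (norm \<eta>)\<^sup>2))"
        unfolding w_def by (intro has_d2_add has_d2_cmult has_d2_norm_sq_line)
      \<comment> \<open>The second derivative along this line is computed in two ways; uniqueness
        identifies \<open>second_deriv w\<close> with the explicit value.\<close>
      moreover have "has_d2 (\<lambda>s. w (snd c p' + s *\<^sub>R \<eta>)) 0
          (frechet_derivative w (at (snd c p')) \<eta>) (second_deriv w (snd c p') \<eta>)"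
        using has_d2_line[OF open_ball _ y, of 0 w \<eta>] w_smooth unfolding smooth_on_def by blast
      ultimately have sd: "second_deriv w (snd c p') \<eta> = (1 - \<epsilon>) * (0 + - 1 * G) + - e * (2 * (norm \<eta>)\<^sup>2)"
        using has_d2_unique by blast
      have "e * (2 * (norm \<eta>)\<^sup>2) \<le> e * (2 * (K * G))"
        unfolding G_def using e K_c[OF p'] by (intro mult_left_mono) auto
      also have "\<dots> = \<epsilon> / 2 * G" using K(1) by (simp add: e_def)
      finally show "- (1 - \<epsilon> / 2) * G \<le> second_deriv w (snd c p') \<eta>"
        unfolding sd by (simp add: algebra_simps)
    qed (use c R(1) K(1) in \<open>auto simp: r_def\<close>)
    moreover have "(1 - \<epsilon>) * u p - \<tau> < w (snd c p)"
    proof -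
      have "u p - \<tau> < (a \<bullet> z + b) + - 1 * f z"
        using ab(2) pc ch by (simp add: f_def z_def)
      then have "(1 - \<epsilon>) * (u p - \<tau>) < (1 - \<epsilon>) * ((a \<bullet> z + b) + - 1 * f z)"
        using \<epsilon> by (intro mult_strict_left_mono) auto
      moreover have "(1 - \<epsilon>) * \<tau> \<le> \<tau>" using \<epsilon> \<tau>(1) by simp
      ultimately show ?thesis by (simp add: w_def z_def algebra_simps)
    qed
    ultimately show "\<exists>c w z r. gluing_piece \<A> g (\<epsilon> / 2) (\<lambda>p. (1 - \<epsilon>) * u p) \<tau> K c w z r \<and> p \<in> fst c \<and>
        norm (snd c p - z) < r / 2 \<and> (1 - \<epsilon>) * u p - \<tau> < w (snd c p)"
      using pc R(1) by (intro exI[of _ c] exI[of _ w] exI[of _ z] exI[of _ r]) (simp add: z_def r_def)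
  qed
qed

section \<open>Log-sum-exp gluing of finitely many pieces\<close>

text \<open>The function is \<open>ln F / k\<close> with \<open>F\<close> the sum of the bump terms.
  \<open>F\<close> is at most \<open>card I * exp (k * v p)\<close> and, by the covering, at least
  \<open>\<mu> * exp (k * (v p - \<tau>))\<close>; after the logarithm the constants cost at most
  \<open>C / k\<close>. The lower bound also keeps \<open>F\<close> positive and supplies the
  dominance needed in \<open>bump_term_barrier_bound\<close>.\<close>

lemma gluing:
  fixes \<A> :: "('a::{t2_space, second_countable_topology}, 'n::finite) chart set"
    and c :: "'i \<Rightarrow> ('a, 'n) chart"
  assumes "hessian_manifold \<A> g" "finite I" and \<epsilon>: "0 < \<epsilon>" "\<epsilon> < 1"
    and piece: "\<And>i. i \<in> I \<Longrightarrow> gluing_piece \<A> g \<epsilon> v \<tau> (K i) (c i) (w i) (z i) (r i)"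
    and cover: "\<And>p. \<exists>i\<in>I. p \<in> fst (c i) \<and> norm (snd (c i) p - z i) < r i / 2 \<and> v p - \<tau> \<le> w i (snd (c i) p)"
  obtains C where "0 \<le> C" "\<And>k. 0 < k \<Longrightarrow> C \<le> k \<Longrightarrow>
    \<exists>f \<in> g_convex_functions \<A> g \<inter> smooth_functions \<A>. \<forall>p. f p \<le> v p + C / k \<and> v p - \<tau> - C / k \<le> f p"
proof -
  have \<A>: "affine_atlas \<A>" and g: "riemannian_metric \<A> g"
    using assms(1) by (auto simp: hessian_manifold_def hessian_metric_def)
  have r: "0 < r i" "0 \<le> K i" "c i \<in> affine_charts \<A>" if "i \<in> I" for i
    using piece[OF that] by (simp_all add: gluing_piece_def)
  have "I \<noteq> {}" using cover by blast
  \<comment> \<open>On the ball of radius \<open>r i / 2\<close> one has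
    \<open>T \<ge> 3 / 4 * (r i)\<^sup>2\<close>; \<open>\<mu>\<close> is the least resulting lower
    bound for \<open>exp (- 1 / T)\<close>.\<close>
  define \<mu> where "\<mu> = Min ((\<lambda>i. exp (- 1 / (3 / 4 * (r i)\<^sup>2))) ` I)"
  have \<mu>: "0 < \<mu>" "\<And>i. i \<in> I \<Longrightarrow> \<mu> \<le> exp (- 1 / (3 / 4 * (r i)\<^sup>2))"
    using assms(2) \<open>I \<noteq> {}\<close> by (auto simp: \<mu>_def)
  define Q where "Q i = barrier (r i) (3 / 4 * (r i)\<^sup>2) + (4 + 48 * (r i)\<^sup>2) / \<mu>" for i
  have Q: "0 \<le> Q i" for i
    unfolding Q_def barrier_def using \<mu>(1) by (intro add_nonneg_nonneg divide_nonneg_nonneg) auto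
  \<comment> \<open>For \<open>k \<ge> C\<close> the first summand lets the barrier terms be
    absorbed by \<open>\<epsilon> g\<close>; the other two control the factors \<open>card I\<close>
    and \<open>\<mu>\<close> after taking logarithms.\<close>
  define C where "C = (\<Sum>i\<in>I. K i * Q i) / \<epsilon> + \<bar>ln (card I)\<bar> + \<bar>ln \<mu>\<bar>"
  have KQ: "0 \<le> (\<Sum>i\<in>I. K i * Q i)" using Q r(2) by (intro sum_nonneg) auto
  have "0 \<le> (\<Sum>i\<in>I. K i * Q i) / \<epsilon>" using KQ \<epsilon> by simp
  then have C: "0 \<le> C" "(\<Sum>i\<in>I. K i * Q i) / \<epsilon> \<le> C" "ln (card I) \<le> C" "- C \<le> ln \<mu>"
    unfolding C_def by linarith+
  show thesis
  proof (rule that[of C])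
    show "0 \<le> C" by (rule C(1))
  next
    fix k :: real assume k: "0 < k" "C \<le> k"
    define H where "H i = bump_term (c i) (w i) (z i) (r i) k" for i
    define F where "F p = (\<Sum>i\<in>I. H i p)" for p
    define f where "f p = (1 / k) * ln (F p)" for p
    have H0: "0 \<le> H i p" for i p by (simp add: H_def bump_term_nonneg)
    have H_le: "H i p \<le> F p" if "i \<in> I" for i p
      unfolding F_def using assms(2) that H0 by (intro member_le_sum) auto
    have lower: "\<mu> * exp (k * (v p - \<tau>)) \<le> F p" for p
    proof -
      obtain i where i: "i \<in> I" "p \<in> fst (c i)" "norm (snd (c i) p - z i) < r i / 2"
        "v p - \<tau> \<le> w i (snd (c i) p)"
        using cover by blast
      define T where "T = (r i)\<^sup>2 - (norm (snd (c i) p - z i))\<^sup>2"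
      have "(norm (snd (c i) p - z i))\<^sup>2 \<le> (r i / 2)\<^sup>2" using i(3) by (intro power_mono) auto
      then have T: "3 / 4 * (r i)\<^sup>2 \<le> T" by (simp add: T_def power_divide)
      have s: "0 < 3 / 4 * (r i)\<^sup>2" using r(1)[OF i(1)] by simp
      have T0: "0 < T" using s T by (rule less_le_trans)
      have "- 1 / (3 / 4 * (r i)\<^sup>2) \<le> - 1 / T"
        unfolding minus_divide_left[symmetric] neg_le_iff_le
        by (intro divide_left_mono T mult_pos_pos T0 s) simp
      then have "\<mu> \<le> exp (- 1 / T)"
        using \<mu>(2)[OF i(1)] by (meson exp_le_cancel_iff order_trans)
      then have "\<mu> \<le> flat 0 T" using T0 by (simp add: flat_def)
      moreover have "exp (k * (v p - \<tau>)) \<le> exp (k * w i (snd (c i) p))"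
        using i(4) k(1) by simp
      ultimately have "\<mu> * exp (k * (v p - \<tau>)) \<le> flat 0 T * exp (k * w i (snd (c i) p))"
        using \<mu>(1) by (intro mult_mono) (auto simp: flat_nonneg)
      also have "\<dots> = H i p" using i(2) by (simp add: H_def bump_term_def T_def)
      also have "\<dots> \<le> F p" by (rule H_le[OF i(1)])
      finally show ?thesis .
    qed
    have F_pos: "0 < F p" for p
      using lower[of p] \<mu>(1) by (meson exp_gt_zero less_le_trans mult_pos_pos)
    have upper: "F p \<le> card I * exp (k * v p)" for p
    proof -
      have "H i p \<le> exp (k * v p)" if "i \<in> I" for i
      proof (cases "p \<in> fst (c i)")
        case True
        then have "w i (snd (c i) p) \<le> v p" using piece[OF that] by (simp add: gluing_piece_def)
        then have "exp (k * w i (snd (c i) p)) * flat 0 ((r i)\<^sup>2 - (norm (snd (c i) p - z i))\<^sup>2) \<le> exp (k * v p) * 1"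
          using k(1) flat_le_fact[of 0] by (intro mult_mono) (auto simp: flat_nonneg)
        then show ?thesis using True by (simp add: H_def bump_term_def)
      qed (simp add: H_def bump_term_def)
      then show ?thesis unfolding F_def by (rule sum_bounded_above)
    qed
    have smooth: "smooth_in_chart d f" if d: "d \<in> affine_charts \<A>" for d
      unfolding smooth_in_chart_def smooth_on_def
    proof
      fix m
      let ?S = "snd d ` fst d"
      have S: "open ?S" by (rule chartD(2)[OF affine_charts_is_chart[OF d]])
      have "Ck_on m ?S (\<lambda>y. (H i \<circ> chart_inv d) y)" if "i \<in> I" for i
      proof -
        have "cball (z i) (r i) \<subseteq> snd (c i) ` fst (c i)" "smooth_on (snd (c i) ` fst (c i)) (w i)"
          using piece[OF that] unfolding gluing_piece_def by blast+
        from smooth_bump_term[OF \<A> r(3)[OF that] d r(1)[OF that] this, of k]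
        show ?thesis unfolding H_def smooth_in_chart_def smooth_on_def by blast
      qed
      then have "Ck_on m ?S (\<lambda>y. \<Sum>i\<in>I. (H i \<circ> chart_inv d) y)"
        by (intro Ck_on_sum S)
      then have "Ck_on m ?S (\<lambda>y. ln (\<Sum>i\<in>I. (H i \<circ> chart_inv d) y))"
        by (rule Ck_on_compose_real[OF S open_greaterThan _ Ck_on_ln, rotated])
          (use F_pos in \<open>auto simp: F_def\<close>)
      then have "Ck_on m ?S (\<lambda>y. (1 / k) * ln (\<Sum>i\<in>I. (H i \<circ> chart_inv d) y))"
        by (intro Ck_on_mult Ck_on_const S)
      then show "Ck_on m ?S (f \<circ> chart_inv d)" by (simp add: f_def F_def comp_def)
    qed
    have "convex_on (snd d ` fst d) ((\<lambda>p. \<phi> p + f p) \<circ> chart_inv d)"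
      if d: "d \<in> affine_charts \<A>" and cvx: "convex (snd d ` fst d)" and pot: "hessian_potential g d \<phi>"
      for d \<phi>
    proof (rule convex_on_has_d2[OF cvx])
      fix y \<eta> assume y: "y \<in> snd d ` fst d"
      have ch: "is_chart d" by (rule affine_charts_is_chart[OF d])
      define p where "p = chart_inv d y"
      have p: "p \<in> fst d" "snd d p = y" using chart_inv_mem[OF ch y] by (simp_all add: p_def)
      define G where "G = \<eta> \<bullet> (g d p *v \<eta>)"
      have G0: "0 \<le> G" unfolding G_def by (rule metric_nonneg[OF g d p(1)])
      have "\<exists>A B \<beta>. has_d2 (\<lambda>s. H i (chart_inv d (y + s *\<^sub>R \<eta>))) 0 A B \<and> (H i p = 0 \<longrightarrow> A = 0) \<and>
          A\<^sup>2 / H i p - \<beta> * H i p \<le> B \<and> \<beta> * H i p \<le> G * (k * (1 - \<epsilon>) * H i p + K i * (Q i * F p))"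
        if i: "i \<in> I" for i
      proof -
        \<comment> \<open>\<open>Q i * F p\<close> is the bound \<open>M\<close> of
          \<open>has_d2_bump_term\<close>: proportional to \<open>F\<close>, so that it survives
          division by \<open>F\<close>.\<close>
        have QF: "0 \<le> Q i * F p" using Q F_pos[of p] by (intro mult_nonneg_nonneg) auto
        have bound: "bump_term (c i) (w i) (z i) (r i) k p * barrier (r i) T \<le> Q i * F p"
          if "p \<in> fst (c i)" "T = (r i)\<^sup>2 - (norm (snd (c i) p - z i))\<^sup>2" "0 < T" for T
          unfolding Q_def using k(1) H_le[OF i, of p]
          by (intro bump_term_barrier_bound[OF piece[OF i] _ that \<mu>(1) lower]) (auto simp: H_def)
        show ?thesis
          by (rule has_d2_bump_term[OF \<A> g d piece[OF i] less_imp_le[OF k(1)] y p_def G_def QF bound])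
            (unfold H_def, blast+)
      qed
      then obtain A B \<beta> where AB: "\<And>i. i \<in> I \<Longrightarrow> has_d2 (\<lambda>s. H i (chart_inv d (y + s *\<^sub>R \<eta>))) 0 (A i) (B i)"
        "\<And>i. i \<in> I \<Longrightarrow> H i p = 0 \<Longrightarrow> A i = 0"
        "\<And>i. i \<in> I \<Longrightarrow> (A i)\<^sup>2 / H i p - \<beta> i * H i p \<le> B i"
        "\<And>i. i \<in> I \<Longrightarrow> \<beta> i * H i p \<le> G * (k * (1 - \<epsilon>) * H i p + K i * (Q i * F p))"
        by metis
      have p0: "chart_inv d (y + 0 *\<^sub>R \<eta>) = p" by (simp add: p_def)
      obtain A' B' where ln: "has_d2 (\<lambda>s. ln (\<Sum>i\<in>I. H i (chart_inv d (y + s *\<^sub>R \<eta>)))) 0 A' B'"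
        "- (\<Sum>i\<in>I. \<beta> i * H i p) / F p \<le> B'"
        using has_d2_ln_sum[of I "\<lambda>i s. H i (chart_inv d (y + s *\<^sub>R \<eta>))" 0 A B \<beta>, unfolded p0]
          assms(2) AB(1-3) H0 F_pos[of p] unfolding F_def by blast
      have "Ck_on (Suc (Suc 0)) (snd d ` fst d) (\<phi> \<circ> chart_inv d)"
        using pot unfolding hessian_potential_def smooth_in_chart_def smooth_on_def by blast
      from has_d2_line[OF chartD(2)[OF ch] this y, of \<eta>]
      have "has_d2 (\<lambda>s. (\<phi> \<circ> chart_inv d) (y + s *\<^sub>R \<eta>)) 0 (frechet_derivative (\<phi> \<circ> chart_inv d) (at y) \<eta>) G"
        using second_deriv_potential[OF ch pot p(1), of \<eta>] by (simp add: p(2) G_def)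
      from has_d2_add[OF this has_d2_cmult[OF ln(1), of "1 / k"]]
      have d2: "has_d2 (\<lambda>s. ((\<lambda>p. \<phi> p + f p) \<circ> chart_inv d) (y + s *\<^sub>R \<eta>)) 0
          (frechet_derivative (\<phi> \<circ> chart_inv d) (at y) \<eta> + 1 / k * A') (G + 1 / k * B')"
        by (simp add: f_def F_def)
      \<comment> \<open>After division by \<open>F\<close> the weights \<open>H i / F\<close> sum to
        \<open>1\<close>, and the barrier contributions become the constant
        \<open>\<Sum>i\<in>I. K i * Q i\<close>.\<close>
      have "(\<Sum>i\<in>I. \<beta> i * H i p) \<le> (\<Sum>i\<in>I. G * (k * (1 - \<epsilon>) * H i p + K i * (Q i * F p)))"
        by (rule sum_mono[OF AB(4)])
      also have "\<dots> = G * (k * (1 - \<epsilon>) + (\<Sum>i\<in>I. K i * Q i)) * F p"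
      proof -
        have "(\<Sum>i\<in>I. K i * (Q i * F p)) = (\<Sum>i\<in>I. K i * Q i) * F p"
          by (simp only: sum_distrib_right mult.assoc)
        moreover have "(\<Sum>i\<in>I. k * (1 - \<epsilon>) * H i p) = k * (1 - \<epsilon>) * F p"
          by (simp only: F_def sum_distrib_left)
        ultimately have "(\<Sum>i\<in>I. G * (k * (1 - \<epsilon>) * H i p + K i * (Q i * F p))) =
            G * (k * (1 - \<epsilon>) * F p + (\<Sum>i\<in>I. K i * Q i) * F p)"
          by (simp only: sum_distrib_left[symmetric] sum.distrib)
        then show ?thesis by (simp only: ring_distribs mult.assoc)
      qed
      finally have "(\<Sum>i\<in>I. \<beta> i * H i p) / F p \<le> G * (k * (1 - \<epsilon>) + (\<Sum>i\<in>I. K i * Q i))"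
        using F_pos[of p] by (simp add: pos_divide_le_eq)
      \<comment> \<open>The decisive absorption: the reserve \<open>k * \<epsilon>\<close> grows
        with \<open>k\<close> and exceeds the fixed sum of the \<open>K i * Q i\<close>, so the
        potential compensates the negative part of the Hessian of \<open>f\<close>.\<close>
      also have "\<dots> \<le> G * k"
      proof (rule mult_left_mono[OF _ G0])
        have "(\<Sum>i\<in>I. K i * Q i) / \<epsilon> \<le> k" using C(2) k(2) by (rule order_trans)
        then have "(\<Sum>i\<in>I. K i * Q i) \<le> k * \<epsilon>" using \<epsilon> by (simp add: pos_divide_le_eq)
        then show "k * (1 - \<epsilon>) + (\<Sum>i\<in>I. K i * Q i) \<le> k" by (simp add: algebra_simps)
      qed
      finally have "- (G * k) \<le> B'" using ln(2) by simp
      then have "0 \<le> G + 1 / k * B'" using k(1) by (simp add: field_simps)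
      then show "\<exists>a b. has_d2 (\<lambda>s. ((\<lambda>p. \<phi> p + f p) \<circ> chart_inv d) (y + s *\<^sub>R \<eta>)) 0 a b \<and> 0 \<le> b"
        using d2 by blast
    qed
    moreover have "continuous_on UNIV f"
    proof (rule continuous_on_UNIV_charts)
      fix p
      obtain d where "d \<in> affine_charts \<A>" "p \<in> fst d"
        using assms(1) unfolding hessian_manifold_def hessian_metric_def by blast
      then show "\<exists>d :: ('a, 'n) chart. is_chart d \<and> p \<in> fst d \<and> smooth_in_chart d f"
        using smooth affine_charts_is_chart by blast
    qed
    ultimately have "f \<in> g_convex_functions \<A> g \<inter> smooth_functions \<A>"
      using smooth by (simp add: g_convex_functions_def smooth_functions_def)
    moreover have "f p \<le> v p + C / k \<and> v p - \<tau> - C / k \<le> f p" for p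
    proof
      have "ln (F p) \<le> ln (card I * exp (k * v p))"
        using upper F_pos by (simp add: ln_mono)
      also have "\<dots> = ln (card I) + k * v p"
        using assms(2) \<open>I \<noteq> {}\<close> by (subst ln_mult) (auto simp: card_gt_0_iff)
      also have "\<dots> \<le> k * v p + C" using C(3) by simp
      finally have "ln (F p) \<le> k * v p + C" .
      then have "1 / k * ln (F p) \<le> 1 / k * (k * v p + C)"
        using k(1) by (intro mult_left_mono) auto
      then show "f p \<le> v p + C / k" using k(1) by (simp add: f_def distrib_left)
      have "ln \<mu> + k * (v p - \<tau>) = ln (\<mu> * exp (k * (v p - \<tau>)))"
        using \<mu>(1) by (simp add: ln_mult)
      also have "\<dots> \<le> ln (F p)"
        using lower[of p] \<mu>(1) F_pos by (simp add: ln_mono)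
      finally have "k * (v p - \<tau>) - C \<le> ln (F p)" using C(4) by linarith
      then have "1 / k * (k * (v p - \<tau>) - C) \<le> 1 / k * ln (F p)"
        using k(1) by (intro mult_left_mono) auto
      then show "v p - \<tau> - C / k \<le> f p" using k(1) by (simp add: f_def right_diff_distrib)
    qed
    ultimately show "\<exists>f \<in> g_convex_functions \<A> g \<inter> smooth_functions \<A>.
        \<forall>p. f p \<le> v p + C / k \<and> v p - \<tau> - C / k \<le> f p" by blast
  qed
qed

section \<open>Compactness and the error estimate\<close>

text \<open>Three errors of at most \<open>e / 4\<close> add up: \<open>v\<close> against
  \<open>u\<close>, the gap \<open>\<tau>\<close>, and the gluing error \<open>C / k\<close>.
  Compactness is used once to choose \<open>\<tau>\<close> and once to select finitely many pieces
  for that \<open>\<tau>\<close>.\<close>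

lemma uniform_approximation:
  fixes \<A> :: "('a::{t2_space, second_countable_topology}, 'n::finite) chart set"
  assumes hess: "hessian_manifold \<A> g" and cpt: "compact (UNIV :: 'a set)"
    and u: "u \<in> g_convex_functions \<A> g" and e: "0 < e"
  shows "\<exists>f \<in> g_convex_functions \<A> g \<inter> smooth_functions \<A>. \<forall>p. \<bar>f p - u p\<bar> < e"
proof -
  have u_cont: "continuous_on UNIV u" using u by (simp add: g_convex_functions_def)
  then have "bounded (range u)"
    using cpt by (intro compact_imp_bounded compact_continuous_image)
  then obtain M where M: "0 < M" "\<And>p. \<bar>u p\<bar> \<le> M"
    unfolding bounded_pos by auto
  \<comment> \<open>The bound \<open>M\<close> on \<open>u\<close> gives
    \<open>\<epsilon> * M \<le> e / 4\<close>, and \<open>1 / 2\<close> keeps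
    \<open>\<epsilon>\<close> below \<open>1\<close>.\<close>
  define \<epsilon> where "\<epsilon> = min (1 / 2) (e / (4 * M))"
  have \<epsilon>: "0 < \<epsilon>" "\<epsilon> < 1" "\<epsilon> \<le> e / (4 * M)" using e M(1) by (auto simp: \<epsilon>_def)
  define v where "v p = (1 - \<epsilon>) * u p" for p
  have v_cont: "continuous_on UNIV v" unfolding v_def by (intro continuous_intros u_cont)
  have uv: "\<bar>v p - u p\<bar> \<le> e / 4" for p
  proof -
    have "\<bar>v p - u p\<bar> = \<epsilon> * \<bar>u p\<bar>" using \<epsilon>(1) by (simp add: v_def algebra_simps abs_mult)
    also have "\<dots> \<le> e / (4 * M) * M" using \<epsilon> M by (intro mult_mono) auto
    finally show ?thesis using M(1) by simp
  qed
  define P where "P K \<tau> p c w z r \<longleftrightarrow> gluing_piece \<A> g (\<epsilon> / 2) v \<tau> K c w z r \<and> p \<in> fst c \<and>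
        norm (snd c p - z) < r / 2 \<and> v p - \<tau> < w (snd c p)" for K \<tau> p c w z r
  have "\<exists>V \<tau>\<^sub>0 K. open V \<and> q \<in> V \<and> 0 < \<tau>\<^sub>0 \<and>
      (\<forall>p \<tau>. p \<in> V \<longrightarrow> 0 < \<tau> \<longrightarrow> \<tau> \<le> \<tau>\<^sub>0 \<longrightarrow> (\<exists>c w z r. P K \<tau> p c w z r))" for q
    by (rule gluing_piece_local[OF hess u \<epsilon>(1,2), of q]) (unfold P_def v_def, blast)
  then obtain V \<tau>\<^sub>0 K where V: "\<And>q. open (V q)" "\<And>q. q \<in> V q" "\<And>q. 0 < \<tau>\<^sub>0 q"
    "\<And>q p \<tau>. p \<in> V q \<Longrightarrow> 0 < \<tau> \<Longrightarrow> \<tau> \<le> \<tau>\<^sub>0 q \<Longrightarrow> \<exists>c w z r. P (K q) \<tau> p c w z r"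
    by metis
  obtain D where D: "finite D" "UNIV = (\<Union>q\<in>D. V q)"
    using compactE_image[OF cpt, of UNIV V] V(1,2) by (metis UNIV_I UN_I subsetI top.extremum_uniqueI)
  \<comment> \<open>Finitely many \<open>V q\<close> cover, so the minimum is positive; inserting
    \<open>e / 4\<close> meets the error budget.\<close>
  define \<tau> where "\<tau> = Min (insert (e / 4) (\<tau>\<^sub>0 ` D))"
  have \<tau>: "0 < \<tau>"
    using D(1) e V(3) by (auto simp: \<tau>_def)
  have "\<tau> \<le> x" if "x \<in> insert (e / 4) (\<tau>\<^sub>0 ` D)" for x
    unfolding \<tau>_def using D(1) that by (intro Min_le) simp_all
  then have \<tau>_le: "\<tau> \<le> e / 4" "\<And>q. q \<in> D \<Longrightarrow> \<tau> \<le> \<tau>\<^sub>0 q" by blast+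
  have "\<exists>K c w z r. P K \<tau> p c w z r" for p
  proof -
    obtain q where "q \<in> D" "p \<in> V q" using D(2) by blast
    then show ?thesis using V(4)[OF _ \<tau> \<tau>_le(2)] by blast
  qed
  then obtain K' c w z r where P: "\<And>p. P (K' p) \<tau> p (c p) (w p) (z p) (r p)"
    by metis
  \<comment> \<open>The strict inequalities at \<open>p\<close> persist on an open set by
    continuity, so the piece chosen for \<open>p\<close> covers a whole neighbourhood.\<close>
  define N where "N p = {x \<in> fst (c p). norm (snd (c p) x - z p) < r p / 2 \<and> v x - \<tau> < w p (snd (c p) x)}" for p
  have "open (N p)" for p
  proof -
    have ch: "is_chart (c p)" and w: "smooth_on (snd (c p) ` fst (c p)) (w p)"
      using P[of p] affine_charts_is_chart unfolding P_def gluing_piece_def by blast+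
    have x: "continuous_on (fst (c p)) (snd (c p))" by (rule chartD(4)[OF ch])
    have "Ck_on 0 (snd (c p) ` fst (c p)) (w p)" using w unfolding smooth_on_def by blast
    then have "continuous_on (fst (c p)) (\<lambda>x. w p (snd (c p) x))"
      using x by (auto intro: continuous_on_compose2)
    then have "open (fst (c p) \<inter> (\<lambda>x. w p (snd (c p) x) - v x) -` {- \<tau><..})"
      using v_cont chartD(1)[OF ch]
      by (intro continuous_open_preimage continuous_on_diff) (auto intro: continuous_on_subset)
    moreover have "open (fst (c p) \<inter> (\<lambda>x. norm (snd (c p) x - z p)) -` {..<r p / 2})"
      using chartD(1)[OF ch] by (intro continuous_open_preimage continuous_intros x) auto
    ultimately have "open ((fst (c p) \<inter> (\<lambda>x. w p (snd (c p) x) - v x) -` {- \<tau><..}) \<inter>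
        (fst (c p) \<inter> (\<lambda>x. norm (snd (c p) x - z p)) -` {..<r p / 2}))"
      by (rule open_Int)
    also have "\<dots> = N p" by (auto simp: N_def)
    finally show ?thesis .
  qed
  moreover have "p \<in> N p" for p using P[of p] by (simp add: P_def N_def)
  ultimately obtain I where I: "finite I" "UNIV = (\<Union>p\<in>I. N p)"
    using compactE_image[OF cpt, of UNIV N] by (metis UNIV_I UN_I subsetI top.extremum_uniqueI)
  have cover: "\<exists>i\<in>I. p \<in> fst (c i) \<and> norm (snd (c i) p - z i) < r i / 2 \<and> v p - \<tau> \<le> w i (snd (c i) p)" for p
  proof -
    obtain i where "i \<in> I" "p \<in> N i" using I(2) by blast
    then show ?thesis by (auto simp: N_def)
  qed
  have piece: "gluing_piece \<A> g (\<epsilon> / 2) v \<tau> (K' i) (c i) (w i) (z i) (r i)" for i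
    using P[of i] by (simp add: P_def)
  have \<epsilon>2: "0 < \<epsilon> / 2" "\<epsilon> / 2 < 1" using \<epsilon> by auto
  obtain C where C: "0 \<le> C" "\<And>k. 0 < k \<Longrightarrow> C \<le> k \<Longrightarrow>
    \<exists>f \<in> g_convex_functions \<A> g \<inter> smooth_functions \<A>. \<forall>p. f p \<le> v p + C / k \<and> v p - \<tau> - C / k \<le> f p"
    using gluing[OF hess I(1) \<epsilon>2 piece cover] by blast
  \<comment> \<open>The three entries ensure positivity, the threshold of \<open>gluing\<close>, and
    \<open>C / k \<le> e / 4\<close>.\<close>
  define k where "k = max 1 (max C (4 * C / e))"
  have "1 \<le> k" "C \<le> k" "4 * C / e \<le> k" by (simp_all add: k_def)
  then have k: "0 < k" "C \<le> k" "C / k \<le> e / 4"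
    using e by (simp_all add: field_simps)
  from C(2)[OF k(1,2)] obtain f where f: "f \<in> g_convex_functions \<A> g \<inter> smooth_functions \<A>"
    "\<And>p. f p \<le> v p + C / k" "\<And>p. v p - \<tau> - C / k \<le> f p"
    by blast
  have "\<bar>f p - u p\<bar> < e" for p
    using f(2,3)[of p] uv[of p] k(3) \<tau>_le(1) e by linarith
  then show ?thesis using f(1) by blast
qed

theorem proposition1p10:
  fixes \<A> :: "('a::{t2_space, second_countable_topology}, 'n::finite) chart set"
    and g :: "('a, 'n) metric"
    and u :: "'a \<Rightarrow> real"
  assumes "hessian_manifold \<A> g"
    and "compact (UNIV :: 'a set)"
    and "u \<in> g_convex_functions \<A> g"
  shows "\<exists>u_seq :: nat \<Rightarrow> 'a \<Rightarrow> real.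
           (\<forall>j. u_seq j \<in> g_convex_functions \<A> g \<inter> smooth_functions \<A>) \<and>
           uniform_limit UNIV u_seq u sequentially"
proof -
  \<comment> \<open>The tolerance uses \<open>Suc j\<close>, so it is positive already for
    \<open>j = 0\<close>, and it tends to \<open>0\<close>.\<close>
  have "\<exists>f. f \<in> g_convex_functions \<A> g \<inter> smooth_functions \<A> \<and> (\<forall>p. \<bar>f p - u p\<bar> < inverse (real (Suc j)))" for j
    using uniform_approximation[OF assms, of "inverse (real (Suc j))"] by auto
  then obtain f where f: "\<And>j. f j \<in> g_convex_functions \<A> g \<inter> smooth_functions \<A>"
    "\<And>j p. \<bar>f j p - u p\<bar> < inverse (real (Suc j))"
    by metis
  have "uniform_limit UNIV f u sequentially"
  proof (rule uniform_limitI)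
    fix e :: real assume "0 < e"
    with LIMSEQ_inverse_real_of_nat have "\<forall>\<^sub>F j in sequentially. inverse (real (Suc j)) < e"
      by (rule order_tendstoD)
    then show "\<forall>\<^sub>F j in sequentially. \<forall>p\<in>UNIV. dist (f j p) (u p) < e"
    proof eventually_elim
      case (elim j)
      show ?case using less_trans[OF f(2) elim] by (simp add: dist_real_def)
    qed
  qed
  then show ?thesis using f(1) by blast
qed

end
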